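(* Let $\alpha\neq0$ and let $u$ be a solution, on its maximal interval of existence $I\subset(0,\infty)$, of $$\frac{u''}{(1-u'^2)^{3/2}}+\frac{u'}{r\sqrt{1-u'^2}}=\frac{\alpha}{u\sqrt{1-u'^2}}$$ with $u>0$ and $u'^2<1$. (1) If $\alpha>0$, the maximal domain of $u$ is $(0,\infty)$. Let $u_0'=\lim_{r\to0}u'(r)$. Then one of the following holds: $u_0'=0$ and $u$ is increasing; $u_0'=-1$ and $u$ has a unique critical point, which is a global minimum; $u_0'=1$ and $u$ is increasing. In all cases $\lim_{r\to\infty}u(r)=\infty$. Moreover, the function $u(r)=\sqrt\alpha\, r$ is a solution of the equation. (2) If $\alpha<0$, the maximal domain of $u$ is $(a,b)$ with $0\le a<b<\infty$, and $\lim_{r\to b}u(r)=0$, $\lim_{r\to b}u'(r)=-1$. If $a>0$, then $u$ has a global maximum and $\lim_{r\to a}u(r)=0$, $\lim_{r\to a}u'(r)=1$. If $a=0$, let $u_0'=\lim_{r\to 0}u'(r)$; then one of the following holds: $u_0'=0$ and $u$ is decreasing; $u_0'=-1$ and $u$ is decreasing; $u_0'=1$ and $u$ has a global maximum.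
   Context: The maximal interval of existence is the largest interval on which the solution exists while satisfying $u>0$ and $u'^2<1$. (The equation is the profile equation of a surface $X(r,\theta)=(r\cos\theta,r\sin\theta,u(r))$ in $\mathbb L^3$ invariant under rotations about the $z$-axis satisfying the $\alpha$-singular maximal surface equation.)
   Formalization: In (1) a fourth alternative is added, u_0'=√α with u(r)=√α r, since for 0<α<1 this solution violates the stated trichotomy; the claim that √α r is a solution is made only for α<1, as u'^2<1 fails otherwise. *)

theory Defs
  imports "HOL-Analysis.Analysis"
begin

text \<open>The alpha-singular maximal surface profile equation, written with p = u', q = u''.\<close>
definition profile_eq :: "real \<Rightarrow> real \<Rightarrow> real \<Rightarrow> real \<Rightarrow> real \<Rightarrow> bool" where
  "profile_eq \<alpha> r v p q \<longleftrightarrow>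
     q / (1 - p\<^sup>2) powr (3/2) + p / (r * sqrt (1 - p\<^sup>2)) = \<alpha> / (v * sqrt (1 - p\<^sup>2))"

definition is_sol :: "real \<Rightarrow> (real \<Rightarrow> real) \<Rightarrow> real set \<Rightarrow> bool" where
  "is_sol \<alpha> u I \<longleftrightarrow> I \<noteq> {} \<and> open I \<and> is_interval I \<and> I \<subseteq> {0<..} \<and>
     (\<forall>r\<in>I. u differentiable (at r) \<and> deriv u differentiable (at r) \<and>
        u r > 0 \<and> (deriv u r)\<^sup>2 < 1 \<and>
        profile_eq \<alpha> r (u r) (deriv u r) (deriv (deriv u) r))"

definition is_max_sol :: "real \<Rightarrow> (real \<Rightarrow> real) \<Rightarrow> real set \<Rightarrow> bool" where
  "is_max_sol \<alpha> u I \<longleftrightarrow> is_sol \<alpha> u I \<and>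
     (\<forall>v J. is_sol \<alpha> v J \<and> I \<subseteq> J \<and> (\<forall>r\<in>I. v r = u r) \<longrightarrow> J = I)"

end

theory Submission
  imports Defs "HOL-Real_Asymp.Real_Asymp"
begin

text \<open>
  Write $S = r u' / \sqrt{1 - u'^2}$. The equation says $S' = \alpha r / (u \sqrt{1 - u'^2})$, so $S$
  is strictly monotone and $u$ has at most one critical point. A maximal solution can only end at
  some $e > 0$ if $u \to 0$ there: otherwise the slope stays away from $\pm 1$ and the solution
  continues. At such an end $u \le |r - e|$, hence $|S'|$ is at least a multiple of $1 / |r - e|$
  and $S$ diverges logarithmically. For $\alpha > 0$ its sign then contradicts $u \to 0$; for
  $\alpha < 0$ this gives $u' \to \pm 1$.

  At the origin the slope tends to $\pm 1$ unless $S \to 0$. If $S \to 0$ and $u(0+) > 0$, then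
  $S' \to 0$ and l'Hospital's rule gives $u' \to 0$. If $S \to 0$ and $u(0+) = 0$, which forces
  $0 < \alpha < 1$, one uses that the equation is autonomous in $\log r$ for $(u / r, u')$ and has
  a Lyapunov function: either $u' \to 1$, or the Lyapunov function is bounded, therefore constant,
  and $u = \sqrt\alpha\, r$.
\<close>

section \<open>Local existence and continuation\<close>

text \<open>The origin is a singular point of the equation, so local existence says nothing there,
  and the slope limit has to come from quantities controlled on a whole interval. The natural
  coordinate is the hyperbolic angle z with u' = tanh z: the constraint u'^2 < 1 becomes finiteness
  of z, and the flux is r sinh z. Since the flux is monotone, sinh z grows in modulus at least like
  1 / r at the origin unless the flux vanishes in the limit. The obstacle is a vertex on the axis,
  u(0+) = 0 with vanishing flux, where the derivative of the flux is an indeterminate quotient.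
  There the cone competes, with a slope that is neither 0 nor 1 in modulus. It is isolated by an
  entropy-like function of u / r and u' that is nonincreasing in r and minimal exactly at the cone.
  If this function is bounded near the origin, it comes arbitrarily close to its minimum there, and
  a nonincreasing function that starts at its minimum is constant.\<close>

lemma picard_lindeloef:
  fixes f :: "real \<Rightarrow> 'a::banach \<Rightarrow> 'a"
  assumes cont: "\<And>x::real \<Rightarrow> 'a. continuous_on UNIV x \<Longrightarrow> continuous_on UNIV (\<lambda>t. f t (x t))"
    and lip: "\<And>t x y. norm (f t x - f t y) \<le> L * norm (x - y)" and "L > 0"
  obtains \<epsilon> x where "\<epsilon> > 0" "x c = x0"
    "\<And>t. t \<in> {c-\<epsilon><..<c+\<epsilon>} \<Longrightarrow> (x has_vector_derivative f t (x t)) (at t)"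
proof -
  \<comment> \<open>\<open>F\<close> is integrated from the left end \<open>A\<close> and corrected
    by \<open>F x c\<close>, so the contraction estimate has two terms, each at most
    \<open>2 * \<epsilon> * L\<close> times the distance. The choice \<open>1 / (8 * L)\<close>
    makes their sum one half.\<close>
  define \<epsilon> where "\<epsilon> = 1 / (8 * L)"
  have e: "\<epsilon> > 0" "4 * \<epsilon> * L = 1/2" using \<open>L > 0\<close> by (auto simp: \<epsilon>_def)
  define A B where "A = c - \<epsilon>" and "B = c + \<epsilon>"
  have AB: "A < B" "A < c" "c < B" "B - A = 2 * \<epsilon>" using e by (auto simp: A_def B_def)
  define F where "F x t = integral {A..t} (\<lambda>s. f s (x s))" for x t
  have cf: "continuous_on S (\<lambda>t. f t (apply_bcontfun x t))" for x S
    by (rule continuous_on_subset[OF cont]) auto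
  have dF: "(F x has_vector_derivative f t (x t)) (at t within {A..B})" if "t \<in> {A..B}"
    for x :: "real \<Rightarrow>\<^sub>C 'a" and t
    unfolding F_def using integral_has_vector_derivative[OF cf that] .
  have g: "clamp A B t \<in> {A..B}" "t \<in> {A..B} \<Longrightarrow> clamp A B t = t" for t
    using clamp_in_interval[of A B t] clamp_cancel_cbox[of t A B] AB by auto
  have cF: "continuous_on {A..B} (F x)" for x :: "real \<Rightarrow>\<^sub>C 'a"
    using dF has_vector_derivative_continuous continuous_on_eq_continuous_within by blast
  \<comment> \<open>Clamping the time extends the Picard operator to bounded continuous functions on
    the whole line, a complete type to which Banach's fixed point theorem applies.\<close>
  have "\<exists>h::real \<Rightarrow>\<^sub>C 'a. \<forall>t. h t = x0 + F x (clamp A B t) - F x c" for x :: "real \<Rightarrow>\<^sub>C 'a"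
    by (rule continuous_on_cbox_bcontfunE[of A B "\<lambda>t. x0 + F x t - F x c"])
      (auto intro!: continuous_intros cF)
  then obtain T :: "(real \<Rightarrow>\<^sub>C 'a) \<Rightarrow> (real \<Rightarrow>\<^sub>C 'a)"
    where T: "\<And>x t. T x t = x0 + F x (clamp A B t) - F x c"
    by metis
  have FF: "norm (F x t - F y t) \<le> 2 * \<epsilon> * L * dist x y" if t: "t \<in> {A..B}" for x y :: "real \<Rightarrow>\<^sub>C 'a" and t
  proof -
    have "F x t - F y t = integral {A..t} (\<lambda>s. f s (x s) - f s (y s))"
      unfolding F_def by (intro integral_diff[symmetric] integrable_continuous_real cf)
    also have "norm \<dots> \<le> (L * dist x y) * (t - A)"
    proof (rule integral_bound)
      show "continuous_on {A..t} (\<lambda>s. f s (x s) - f s (y s))" by (intro continuous_intros cf)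
      fix s show "norm (f s (x s) - f s (y s)) \<le> L * dist x y"
        using lip[of s "x s" "y s"] dist_bounded[of x s y] \<open>L > 0\<close>
        by (smt (verit) dist_norm mult_left_mono)
    qed (use t in auto)
    also have "\<dots> \<le> (L * dist x y) * (2 * \<epsilon>)"
      using t AB \<open>L > 0\<close> by (intro mult_left_mono) auto
    finally show ?thesis by (simp add: algebra_simps)
  qed
  have "dist (T x) (T y) \<le> 1/2 * dist x y" for x y
  proof (rule dist_bound)
    fix t
    have "dist (T x t) (T y t) = norm ((F x (clamp A B t) - F y (clamp A B t)) - (F x c - F y c))"
      by (simp add: T dist_norm algebra_simps)
    also have "\<dots> \<le> norm (F x (clamp A B t) - F y (clamp A B t)) + norm (F x c - F y c)" by (rule norm_triangle_ineq4)
    also have "\<dots> \<le> 4 * \<epsilon> * L * dist x y" using FF[of "clamp A B t" x y] FF[of c x y] g AB by auto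
    finally show "dist (T x t) (T y t) \<le> 1/2 * dist x y" unfolding e(2) .
  qed
  then obtain X where X: "T X = X" using banach_fix_type[of "1/2" T] by auto
  have XX: "X t = x0 + F X (clamp A B t) - F X c" for t using T[of X t] X by simp
  show ?thesis
  proof (rule that[of \<epsilon> X])
    show "X c = x0" using XX[of c] g AB by simp
    fix t assume "t \<in> {c-\<epsilon><..<c+\<epsilon>}"
    then have t: "A < t" "t < B" by (auto simp: A_def B_def)
    have "(F X has_vector_derivative f t (X t)) (at t)"
      using dF[of t X] t by (simp add: at_within_Icc_at)
    then have "((\<lambda>t. x0 + F X t - F X c) has_vector_derivative f t (X t)) (at t)"
      by (auto intro!: derivative_eq_intros)
    then show "(X has_vector_derivative f t (X t)) (at t)"
      by (rule has_vector_derivative_transform_within_open[where S = "{A<..<B}"])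
        (use t in \<open>auto simp: XX g\<close>)
  qed (use e in auto)
qed

section \<open>The equation solved for u'', and the joining of solutions\<close>

lemma profile_eq_iff:
  assumes "0 < r" "0 < v" "p\<^sup>2 < 1"
  shows "profile_eq \<alpha> r v p q \<longleftrightarrow> q = (1 - p\<^sup>2) * (\<alpha> / v - p / r)"
proof -
  define s where "s = sqrt (1 - p\<^sup>2)"
  have s: "s > 0" "1 - p\<^sup>2 = s\<^sup>2" using assms by (auto simp: s_def)
  have pw: "(s\<^sup>2) powr (3/2) = s ^ 3"
    using s(1) powr_realpow[of s 2] powr_realpow[of s 3] powr_powr[of s 2 "3/2"] by simp
  \<comment> \<open>All three terms get the denominator \<open>s ^ 3\<close>, which is the power 3/2
    of \<open>1 - p\<^sup>2\<close>; after \<open>cancel\<close> the explicit equation for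
    \<open>q\<close> is left.\<close>
  have fr: "x / (y * s) = s\<^sup>2 * (x / y) / s ^ 3" for x y
    using s(1) by (simp add: power2_eq_square power3_eq_cube)
  have cancel: "q / k + a / k = b / k \<longleftrightarrow> q = b - a" if "k \<noteq> 0" for a b k :: real
    using that by (auto simp flip: add_divide_distrib)
  show ?thesis
    unfolding profile_eq_def s(2) real_sqrt_abs abs_of_pos[OF s(1)] pw fr right_diff_distrib
    by (rule cancel) (use s(1) in simp)
qed

lemma is_solD:
  assumes "is_sol \<alpha> u I" "r \<in> I"
  shows "0 < r" "0 < u r" "(deriv u r)\<^sup>2 < 1" "(u has_real_derivative deriv u r) (at r)"
    "(deriv u has_real_derivative (1 - (deriv u r)\<^sup>2) * (\<alpha> / u r - deriv u r / r)) (at r)"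
proof -
  have r: "0 < r" "0 < u r" "(deriv u r)\<^sup>2 < 1" "u differentiable (at r)" "deriv u differentiable (at r)"
    "profile_eq \<alpha> r (u r) (deriv u r) (deriv (deriv u) r)"
    using assms unfolding is_sol_def by auto
  then show "0 < r" "0 < u r" "(deriv u r)\<^sup>2 < 1" by auto
  show "(u has_real_derivative deriv u r) (at r)"
    using r(4) by (simp add: DERIV_deriv_iff_real_differentiable)
  show "(deriv u has_real_derivative (1 - (deriv u r)\<^sup>2) * (\<alpha> / u r - deriv u r / r)) (at r)"
    using r(5,6) unfolding profile_eq_iff[OF r(1-3)]
    by (simp flip: DERIV_deriv_iff_real_differentiable)
qed

lemma is_solI:
  assumes "I \<noteq> {}" "open I" "is_interval I"
    and I: "\<And>r. r \<in> I \<Longrightarrow> 0 < r \<and> 0 < u r \<and> (p r)\<^sup>2 < 1 \<and> (u has_real_derivative p r) (at r) \<and>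
      (p has_real_derivative (1 - (p r)\<^sup>2) * (\<alpha> / u r - p r / r)) (at r)"
  shows "is_sol \<alpha> u I"
proof -
  have p: "deriv u r = p r" if "r \<in> I" for r using I[OF that] by (simp add: DERIV_imp_deriv)
  have pp: "(deriv u has_real_derivative (1 - (p r)\<^sup>2) * (\<alpha> / u r - p r / r)) (at r)" if "r \<in> I" for r
    by (rule has_field_derivative_transform_within_open[of p _ _ I]) (use I p that assms in auto)
  show ?thesis unfolding is_sol_def
  proof (intro conjI ballI assms)
    show "I \<subseteq> {0<..}" using I by auto
    fix r assume r: "r \<in> I"
    show "u differentiable (at r)" "deriv u differentiable (at r)" "u r > 0" "(deriv u r)\<^sup>2 < 1"
      using I[OF r] pp[OF r] p[OF r] by (auto simp: real_differentiable_def)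
    show "profile_eq \<alpha> r (u r) (deriv u r) (deriv (deriv u) r)"
      using I[OF r] DERIV_imp_deriv[OF pp[OF r]] by (simp add: profile_eq_iff p[OF r])
  qed
qed

lemma is_sol_subset:
  assumes "is_sol \<alpha> u I" "J \<subseteq> I" "J \<noteq> {}" "open J" "is_interval J"
  shows "is_sol \<alpha> u J"
  using assms unfolding is_sol_def by blast

text \<open>The joined function coincides with \<open>u\<close> on all of \<open>I\<close> and with
  \<open>w\<close> on all of \<open>K\<close>; as both sets are open, the two derivatives
  transfer.\<close>

lemma is_sol_Un:
  assumes u: "is_sol \<alpha> u I" and w: "is_sol \<alpha> w K" and "I \<inter> K \<noteq> {}"
    and eq: "\<And>r. r \<in> I \<inter> K \<Longrightarrow> w r = u r"
  shows "is_sol \<alpha> (\<lambda>r. if r \<in> I then u r else w r) (I \<union> K)"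
proof (rule is_solI)
  let ?v = "\<lambda>r. if r \<in> I then u r else w r"
  have IK: "open I" "open K" "connected I" "connected K"
    using u w by (auto simp: is_sol_def is_interval_connected_1)
  then show "open (I \<union> K)" by auto
  show "I \<union> K \<noteq> {}" using assms(3) by auto
  show "is_interval (I \<union> K)" using IK assms(3) by (auto simp: is_interval_connected_1 intro: connected_Un)
  fix r assume "r \<in> I \<union> K"
  then have "r \<in> I \<and> (\<forall>s\<in>I. u s = ?v s) \<or> r \<in> K \<and> (\<forall>s\<in>K. w s = ?v s)" using eq by auto
  then obtain J y where J: "open J" "r \<in> J" "is_sol \<alpha> y J" "\<And>s. s \<in> J \<Longrightarrow> y s = ?v s"
    using IK(1,2) u w by blast
  have d: "(?v has_real_derivative deriv y s) (at s)" if "s \<in> J" for s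
    by (rule has_field_derivative_transform_within_open[OF is_solD(4)[OF J(3) that] J(1) that J(4)])
  then have d': "deriv ?v s = deriv y s" if "s \<in> J" for s
    using that by (auto intro: DERIV_imp_deriv)
  have "(deriv ?v has_real_derivative (1 - (deriv y r)\<^sup>2) * (\<alpha> / y r - deriv y r / r)) (at r)" 
    by (rule has_field_derivative_transform_within_open[OF is_solD(5)[OF J(3,2)] J(1,2)]) (simp add: d')
  then show "0 < r \<and> 0 < ?v r \<and> (deriv ?v r)\<^sup>2 < 1 \<and> (?v has_real_derivative deriv ?v r) (at r) \<and>
      (deriv ?v has_real_derivative (1 - (deriv ?v r)\<^sup>2) * (\<alpha> / ?v r - deriv ?v r / r)) (at r)"
    using is_solD(1-3)[OF J(3,2)] J(4)[OF J(2)] d[OF J(2)] d'[OF J(2)] by simp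
qed

text \<open>L'Hospital's rule for the difference quotient. At a gluing point it produces the
  derivatives of u and u' from limits alone.\<close>

lemma has_real_derivative_if_limit:
  fixes f g :: "real \<Rightarrow> real"
  assumes "isCont f c" and "\<forall>\<^sub>F x in at c. (f has_real_derivative g x) (at x)" and "(g \<longlongrightarrow> l) (at c)"
  shows "(f has_real_derivative l) (at c)"
proof -
  have "((\<lambda>x. (f x - f c) / (x - c)) \<longlongrightarrow> l) (at c)"
  proof (rule lhopital[where f' = g and g' = "\<lambda>_. 1"])
    show "((\<lambda>x. f x - f c) \<longlongrightarrow> 0) (at c)" using assms(1) by (simp add: isCont_def LIM_zero)
    show "((\<lambda>x. x - c) \<longlongrightarrow> 0) (at c)" by (auto intro!: tendsto_eq_intros)
    show "\<forall>\<^sub>F x in at c. x - c \<noteq> 0" by (auto simp: eventually_at_filter)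
    show "\<forall>\<^sub>F x in at c. ((\<lambda>x. f x - f c) has_real_derivative g x) (at x)"
      using assms(2) by eventually_elim (auto intro!: derivative_eq_intros)
    show "\<forall>\<^sub>F x in at c. ((\<lambda>x. x - c) has_real_derivative 1) (at x)"
      by (intro always_eventually allI) (auto intro!: derivative_eq_intros)
  qed (use assms in auto)
  then show ?thesis by (simp add: has_field_derivative_iff)
qed

text \<open>The gap at \<open>c\<close> closes because the equation is explicit in u'': when the
  limits of u and u' from both sides match, so do the limits of u''.\<close>

lemma is_sol_glue:
  assumes u: "is_sol \<alpha> u {c-\<eta><..<c}" and v: "is_sol \<alpha> v {c<..<c+\<eta>}" and "\<eta> > 0" "c > 0"
    and u1: "(u \<longlongrightarrow> u1) (at_left c)" "(v \<longlongrightarrow> u1) (at_right c)" "u1 > 0"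
    and p1: "(deriv u \<longlongrightarrow> p1) (at_left c)" "(deriv v \<longlongrightarrow> p1) (at_right c)" "p1\<^sup>2 < 1"
  shows "\<exists>w. is_sol \<alpha> w {c-\<eta><..<c+\<eta>} \<and> (\<forall>r<c. w r = u r) \<and> (\<forall>r>c. w r = v r)"
proof -
  define w where "w r = (if r < c then u r else if r = c then u1 else v r)" for r
  define p where "p r = (if r < c then deriv u r else if r = c then p1 else deriv v r)" for r
  define q where "q r = (1 - (p r)\<^sup>2) * (\<alpha> / w r - p r / r)" for r
  have L: "w r = u r \<and> p r = deriv u r" if "r \<in> {..<c}" for r using that by (auto simp: w_def p_def)
  have R: "w r = v r \<and> p r = deriv v r" if "r \<in> {c<..}" for r using that by (auto simp: w_def p_def)
  have off: "0 < r \<and> 0 < w r \<and> (p r)\<^sup>2 < 1 \<and> (w has_real_derivative p r) (at r) \<and>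
      (p has_real_derivative q r) (at r)" if "r \<in> {c-\<eta><..<c+\<eta>}" "r \<noteq> c" for r
  proof (cases "r < c")
    case True
    then have r: "r \<in> {c-\<eta><..<c}" using that by auto
    have "(w has_real_derivative deriv u r) (at r)"
      by (rule has_field_derivative_transform_within_open[of u _ _ "{..<c}"])
        (use is_solD[OF u r] L True in auto)
    moreover have "(p has_real_derivative (1 - (deriv u r)\<^sup>2) * (\<alpha> / u r - deriv u r / r)) (at r)"
      by (rule has_field_derivative_transform_within_open[of "deriv u" _ _ "{..<c}"])
        (use is_solD[OF u r] L True in auto)
    ultimately show ?thesis using is_solD[OF u r] L True by (simp add: q_def)
  next
    case False
    then have r: "r \<in> {c<..<c+\<eta>}" using that by auto
    have "(w has_real_derivative deriv v r) (at r)"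
      by (rule has_field_derivative_transform_within_open[of v _ _ "{c<..}"])
        (use is_solD[OF v r] R r in auto)
    moreover have "(p has_real_derivative (1 - (deriv v r)\<^sup>2) * (\<alpha> / v r - deriv v r / r)) (at r)"
      by (rule has_field_derivative_transform_within_open[of "deriv v" _ _ "{c<..}"])
        (use is_solD[OF v r] R r in auto)
    ultimately show ?thesis using is_solD[OF v r] R r by (simp add: q_def)
  qed
  have ev: "\<forall>\<^sub>F r in at c. r \<in> {c-\<eta><..<c+\<eta>} \<and> r \<noteq> c"
    using eventually_at_in_open[of "{c-\<eta><..<c+\<eta>}" c] \<open>\<eta> > 0\<close> by (auto elim: eventually_mono)
  have cw: "(w \<longlongrightarrow> u1) (at c)"
    unfolding filterlim_at_split
  proof
    show "(w \<longlongrightarrow> u1) (at_left c)"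
      by (rule Lim_transform_eventually[OF u1(1)]) (auto simp: eventually_at_filter w_def)
    show "(w \<longlongrightarrow> u1) (at_right c)"
      by (rule Lim_transform_eventually[OF u1(2)]) (auto simp: eventually_at_filter w_def)
  qed
  have cp: "(p \<longlongrightarrow> p1) (at c)"
    unfolding filterlim_at_split
  proof
    show "(p \<longlongrightarrow> p1) (at_left c)"
      by (rule Lim_transform_eventually[OF p1(1)]) (auto simp: eventually_at_filter p_def)
    show "(p \<longlongrightarrow> p1) (at_right c)"
      by (rule Lim_transform_eventually[OF p1(2)]) (auto simp: eventually_at_filter p_def)
  qed
  have c: "w c = u1" "p c = p1" by (auto simp: w_def p_def)
  have dw: "(w has_real_derivative p1) (at c)"
  proof (rule has_real_derivative_if_limit)
    show "\<forall>\<^sub>F r in at c. (w has_real_derivative p r) (at r)"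
      using ev by (rule eventually_mono) (use off in blast)
  qed (use cw cp c in \<open>auto simp: isCont_def\<close>)
  have "(q \<longlongrightarrow> q c) (at c)"
    unfolding q_def c using u1(3) \<open>c > 0\<close> by (intro tendsto_intros cp cw) auto
  then have dp: "(p has_real_derivative q c) (at c)"
  proof (rule has_real_derivative_if_limit[rotated 2])
    show "\<forall>\<^sub>F r in at c. (p has_real_derivative q r) (at r)"
      using ev by (rule eventually_mono) (use off in blast)
  qed (use cp c in \<open>auto simp: isCont_def\<close>)
  have "is_sol \<alpha> w {c-\<eta><..<c+\<eta>}"
  proof (rule is_solI)
    fix r assume r: "r \<in> {c-\<eta><..<c+\<eta>}"
    have "0 < r \<and> 0 < w r \<and> (p r)\<^sup>2 < 1 \<and> (w has_real_derivative p r) (at r) \<and> (p has_real_derivative q r) (at r)"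
    proof (cases "r = c")
      case True
      then show ?thesis using c dw dp u1(3) p1(3) \<open>c > 0\<close> by simp
    qed (use off r in blast)
    then show "0 < r \<and> 0 < w r \<and> (p r)\<^sup>2 < 1 \<and> (w has_real_derivative p r) (at r) \<and>
      (p has_real_derivative (1 - (p r)\<^sup>2) * (\<alpha> / w r - p r / r)) (at r)" by (simp add: q_def)
  qed (use \<open>\<eta> > 0\<close> in \<open>auto simp: is_interval_connected_1\<close>)
  then show ?thesis by (intro exI[of _ w]) (auto simp: w_def)
qed

lemma abs_tanh_diff_le: "\<bar>tanh x - tanh y\<bar> \<le> \<bar>x - y\<bar>" for x y :: real
proof -
  have "norm (tanh x - tanh y) \<le> 1 * norm (x - y)"
  proof (rule field_differentiable_bound[of UNIV tanh "\<lambda>x. 1 - (tanh x)\<^sup>2"])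
    show "norm (1 - (tanh z)\<^sup>2) \<le> 1" for z :: real
      using tanh_real_bounds[of z] by (simp add: abs_square_le_1 abs_le_iff)
  qed (auto intro!: derivative_eq_intros)
  then show ?thesis by simp
qed

lemma tanh_artanh_real:
  fixes p :: real
  assumes "p\<^sup>2 < 1"
  shows "tanh (artanh p) = p"
proof -
  have p: "-1 < p" "p < 1" using assms by (auto simp: abs_square_less_1)
  define y where "y = (1 + p) / (1 - p)"
  have y: "y > 0" using p by (simp add: y_def)
  have "artanh p = ln (sqrt y)" using y by (simp add: artanh_def y_def ln_sqrt)
  then have "tanh (artanh p) = (y - 1) / (y + 1)" using y by (simp add: tanh_ln_real)
  also have "\<dots> = p" using p by (simp add: y_def divide_simps)
  finally show ?thesis .
qed

text \<open>
  For $u' = \tanh z$ the equation reads $z' = \alpha / u - \tanh z / r$. Cutting off both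
  denominators away from 0 makes this first-order system globally Lipschitz.
\<close>

lemma is_sol_local:
  assumes "c > 0" "u1 > 0" "p1\<^sup>2 < 1"
  obtains \<eta> v where "\<eta> > 0" "is_sol \<alpha> v {c-\<eta><..<c+\<eta>}" "v c = u1" "deriv v c = p1"
proof -
  define f :: "real \<Rightarrow> real \<times> real \<Rightarrow> real \<times> real"
    where "f t X = (tanh (snd X), \<alpha> / max (fst X) (u1/2) - tanh (snd X) / max t (c/2))" for t X
  \<comment> \<open>The summands are, in this order, Lipschitz constants of \<open>tanh\<close>, of
    the cut-off term with \<open>\<alpha>\<close>, and of \<open>tanh\<close> over the cut-off
    radius.\<close>
  define L where "L = 1 + \<bar>\<alpha>\<bar> / (u1/2)\<^sup>2 + 1 / (c/2)"
  have inv: "\<bar>1 / max x m - 1 / max y m\<bar> \<le> \<bar>x - y\<bar> / m\<^sup>2" if "m > 0" for x y m :: real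
  proof -
    have "1 / max x m - 1 / max y m = (max y m - max x m) / (max x m * max y m)"
      using that by (simp add: field_simps)
    also have "\<bar>\<dots>\<bar> = \<bar>max y m - max x m\<bar> / (max x m * max y m)"
      using that by (simp add: abs_mult)
    also have "\<dots> \<le> \<bar>x - y\<bar> / (m * m)"
      using that by (intro frac_le mult_mono) auto
    finally show ?thesis by (simp add: power2_eq_square)
  qed
  have lip: "norm (f t X - f t Y) \<le> L * norm (X - Y)" for t X Y
  proof -
    have fs: "\<bar>fst X - fst Y\<bar> \<le> norm (X - Y)" "\<bar>snd X - snd Y\<bar> \<le> norm (X - Y)"
      using dist_fst_le[of X Y] dist_snd_le[of X Y] by (auto simp: dist_norm)
    have t: "\<bar>tanh (snd X) - tanh (snd Y)\<bar> \<le> norm (X - Y)"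
      using abs_tanh_diff_le[of "snd X" "snd Y"] fs by linarith
    define A B where "A = \<alpha> / max (fst X) (u1/2) - \<alpha> / max (fst Y) (u1/2)"
      and "B = (tanh (snd X) - tanh (snd Y)) / max t (c/2)"
    have "\<bar>A\<bar> = \<bar>\<alpha>\<bar> * \<bar>1 / max (fst X) (u1/2) - 1 / max (fst Y) (u1/2)\<bar>"
      by (simp add: A_def right_diff_distrib flip: abs_mult)
    also have "\<dots> \<le> \<bar>\<alpha>\<bar> * (norm (X - Y) / (u1/2)\<^sup>2)"
      using order_trans[OF inv[of "u1/2" "fst X" "fst Y"] divide_right_mono[OF fs(1)]] assms
      by (intro mult_left_mono) auto
    finally have A: "\<bar>A\<bar> \<le> \<bar>\<alpha>\<bar> / (u1/2)\<^sup>2 * norm (X - Y)" by simp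
    have "\<bar>B\<bar> = \<bar>tanh (snd X) - tanh (snd Y)\<bar> / max t (c/2)" using assms by (simp add: B_def)
    also have "\<dots> \<le> norm (X - Y) / (c/2)" using t assms by (intro frac_le) auto
    finally have B: "\<bar>B\<bar> \<le> 1 / (c/2) * norm (X - Y)" by (simp add: mult.commute)
    have "f t X - f t Y = (tanh (snd X) - tanh (snd Y), A - B)"
      by (simp add: f_def A_def B_def diff_divide_distrib)
    then have "norm (f t X - f t Y) \<le> \<bar>tanh (snd X) - tanh (snd Y)\<bar> + \<bar>A - B\<bar>"
      using norm_Pair_le[of "tanh (snd X) - tanh (snd Y)" "A - B"] by simp
    also have "\<dots> \<le> norm (X - Y) + (\<bar>\<alpha>\<bar> / (u1/2)\<^sup>2 * norm (X - Y) + 1 / (c/2) * norm (X - Y))"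
      using t A B by linarith
    also have "\<dots> = L * norm (X - Y)" by (simp only: L_def distrib_right mult_1)
    finally show ?thesis .
  qed
  have cont: "continuous_on UNIV (\<lambda>t. f t (x t))" if "continuous_on UNIV x" for x
    unfolding f_def using that assms by (intro continuous_intros) (auto simp: max_def)
  have "L > 0" using assms by (auto simp: L_def intro!: add_pos_nonneg)
  from picard_lindeloef[OF cont lip this, of c "(u1, artanh p1)"]
  obtain \<epsilon> X where e: "\<epsilon> > 0" and X0: "X c = (u1, artanh p1)" and X: "\<And>t. t \<in> {c-\<epsilon><..<c+\<epsilon>} \<Longrightarrow>
      (X has_vector_derivative f t (X t)) (at t)"
    by metis
  define v z where "v t = fst (X t)" and "z t = snd (X t)" for t
  have dv: "(v has_real_derivative tanh (z t)) (at t)" if "t \<in> {c-\<epsilon><..<c+\<epsilon>}" for t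
    using bounded_linear.has_vector_derivative[OF bounded_linear_fst X[OF that]]
    by (simp add: f_def v_def[abs_def] z_def[abs_def] has_real_derivative_iff_has_vector_derivative)
  have dz: "(z has_real_derivative \<alpha> / max (v t) (u1/2) - tanh (z t) / max t (c/2)) (at t)"
    if "t \<in> {c-\<epsilon><..<c+\<epsilon>}" for t
    using bounded_linear.has_vector_derivative[OF bounded_linear_snd X[OF that]]
    by (simp add: f_def v_def[abs_def] z_def[abs_def] has_real_derivative_iff_has_vector_derivative)
  have c: "v c = u1" "z c = artanh p1" by (auto simp: v_def z_def X0)
  have "isCont v c" using dv[of c] e by (auto intro: DERIV_isCont)
  then obtain \<delta> where d: "\<delta> > 0" "\<And>t. dist t c < \<delta> \<Longrightarrow> dist (v t) (v c) < u1/2"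
    unfolding continuous_at_eps_delta using assms(2) by (meson half_gt_zero)
  \<comment> \<open>On this interval both maxima in \<open>f\<close> return their first argument, so
    the cut-off system agrees with the true one.\<close>
  define \<eta> where "\<eta> = min (min \<epsilon> \<delta>) (c/2)"
  have \<eta>: "\<eta> > 0" using e d assms by (auto simp: \<eta>_def)
  have near: "t \<in> {c-\<epsilon><..<c+\<epsilon>} \<and> v t > u1/2 \<and> t > c/2" if "t \<in> {c-\<eta><..<c+\<eta>}" for t
  proof -
    have "dist t c < \<delta>" using that by (auto simp: \<eta>_def dist_real_def)
    then have "v t > u1/2" using d(2)[of t] c(1) unfolding dist_real_def by linarith
    then show ?thesis using that by (auto simp: \<eta>_def)
  qed
  show ?thesis
  proof (rule that[of \<eta> v])
    show "is_sol \<alpha> v {c-\<eta><..<c+\<eta>}"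
    proof (rule is_solI)
      fix t assume "t \<in> {c-\<eta><..<c+\<eta>}"
      note t = near[OF this]
      have "(z has_real_derivative \<alpha> / v t - tanh (z t) / t) (at t)" using dz[of t] t by (simp add: max_def)
      then have "((\<lambda>t. tanh (z t)) has_real_derivative (1 - (tanh (z t))\<^sup>2) * (\<alpha> / v t - tanh (z t) / t)) (at t)"
        by (auto intro!: derivative_eq_intros)
      moreover have "(tanh (z t))\<^sup>2 < 1"
        using tanh_real_bounds[of "z t"] by (simp add: abs_square_less_1 abs_less_iff)
      ultimately show "0 < t \<and> 0 < v t \<and> (tanh (z t))\<^sup>2 < 1 \<and> (v has_real_derivative tanh (z t)) (at t) \<and>
        ((\<lambda>t. tanh (z t)) has_real_derivative (1 - (tanh (z t))\<^sup>2) * (\<alpha> / v t - tanh (z t) / t)) (at t)"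
        using t dv[of t] assms by auto
    qed (use \<eta> in \<open>auto simp: is_interval_connected_1\<close>)
    have "tanh (artanh p1) = p1"
      using assms(3) by (rule tanh_artanh_real)
    then show "deriv v c = p1" using dv[of c] e c by (auto intro: DERIV_imp_deriv)
  qed (use \<eta> c in auto)
qed

section \<open>Limits of u and u' at the ends of the interval\<close>

locale profile_solution =
  fixes \<alpha> :: real and u :: "real \<Rightarrow> real" and I :: "real set"
  assumes sol: "is_sol \<alpha> u I"
begin

lemmas pos = is_solD(1,2)[OF sol]
lemmas slope_less = is_solD(3)[OF sol]
lemmas du = is_solD(4)[OF sol]
lemmas ddu = is_solD(5)[OF sol]

lemma slope_bounds:
  assumes "r \<in> I"
  shows "-1 < deriv u r" "deriv u r < 1" "1 - (deriv u r)\<^sup>2 > 0"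
  using slope_less[OF assms] by (auto simp: abs_square_less_1)

lemma I_interval: "is_interval I"
  using sol by (simp add: is_sol_def)

lemma I_between: "x \<in> I \<Longrightarrow> y \<in> I \<Longrightarrow> x \<le> z \<Longrightarrow> z \<le> y \<Longrightarrow> z \<in> I"
  using I_interval unfolding is_interval_1 by blast

lemma u_lipschitz:
  assumes "x \<in> I" "y \<in> I"
  shows "\<bar>u x - u y\<bar> \<le> \<bar>x - y\<bar>"
proof -
  have "norm (u x - u y) \<le> 1 * norm (x - y)"
  proof (rule field_differentiable_bound[of I u "deriv u"])
    show "convex I" using I_interval by (simp add: is_interval_convex_1)
    show "(u has_field_derivative deriv u z) (at z within I)" if "z \<in> I" for z
      using du[OF that] by (rule has_field_derivative_at_within)
    show "norm (deriv u z) \<le> 1" if "z \<in> I" for z using slope_bounds[OF that] by auto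
  qed (use assms in auto)
  then show ?thesis by simp
qed

text \<open>The slope bound makes \<open>u\<close> 1-Lipschitz, so it extends continuously to every
  finite end, the origin included.\<close>

lemma u_limit:
  assumes "J \<subseteq> I" "e \<in> closure J" "e \<notin> J"
  obtains L where "0 \<le> L" "(u \<longlongrightarrow> L) (at e within J)"
proof -
  have "1-lipschitz_on J u"
    using u_lipschitz[OF subsetD[OF assms(1)] subsetD[OF assms(1)]] by (auto intro!: lipschitz_onI simp: dist_real_def)
  then obtain L where L: "(u \<longlongrightarrow> L) (at e within J)"
    using uniformly_continuous_on_extension_at_closure[OF lipschitz_on_uniformly_continuous assms(2)] by blast
  moreover have "0 \<le> L"
  proof (rule tendsto_lowerbound[OF L])
    show "\<forall>\<^sub>F r in at e within J. 0 \<le> u r"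
      using pos assms(1) by (auto simp: eventually_at_filter less_imp_le subset_iff)
    show "at e within J \<noteq> bot"
      using assms by (simp add: trivial_limit_within islimpt_in_closure)
  qed
  ultimately show ?thesis using that by blast
qed

text \<open>
  The function $\mathrm{artanh}\, u'$ has derivative $\alpha / u - u' / r$, so it is Lipschitz
  as long as $u$ and $r$ stay away from 0.
\<close>

lemma slope_limit:
  assumes J: "J \<subseteq> I" "convex J" "e \<in> closure J" "e \<notin> J" "e > 0"
    and L: "L > 0" "(u \<longlongrightarrow> L) (at e within J)"
  obtains p1 where "p1\<^sup>2 < 1" "(deriv u \<longlongrightarrow> p1) (at e within J)"
proof -
  have "\<forall>\<^sub>F r in at e within J. u r > L/2" using order_tendstoD(1)[OF L(2), of "L/2"] L(1) by simp
  then obtain d where d: "d > 0" "\<And>r. r \<in> J \<Longrightarrow> dist r e < d \<Longrightarrow> u r > L/2"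
    unfolding eventually_at using J(4) by metis
  \<comment> \<open>On \<open>K\<close> both \<open>u\<close> and \<open>r\<close> exceed half of
    their limits, which gives the constant \<open>B\<close>. Intersecting with a ball keeps
    \<open>K\<close> convex, as the mean value bound requires.\<close>
  define K where "K = J \<inter> ball e (min d (e/2))"
  define z where "z r = artanh (deriv u r)" for r
  define B where "B = \<bar>\<alpha>\<bar> / (L/2) + 1 / (e/2)"
  have K: "r \<in> I" "u r > L/2" "r > e/2" if "r \<in> K" for r
  proof -
    have r: "r \<in> J" "dist r e < d" "dist r e < e/2" using that by (auto simp: K_def dist_commute)
    then show "r \<in> I" "u r > L/2" using J(1) d(2) by auto
    show "r > e/2" using r(3) unfolding dist_real_def by linarith
  qed
  have "norm (z x - z y) \<le> B * norm (x - y)" if "x \<in> K" "y \<in> K" for x y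
  proof (rule field_differentiable_bound[of K])
    show "convex K" unfolding K_def using J(2) by (intro convex_Int) auto
    fix r assume r: "r \<in> K"
    have p: "\<bar>deriv u r\<bar> < 1" using slope_bounds[OF K(1)[OF r]] by auto
    have "(z has_real_derivative \<alpha> / u r - deriv u r / r) (at r)"
      unfolding z_def using slope_bounds[OF K(1)[OF r]]
        DERIV_chain2[OF artanh_real_has_field_derivative[OF p] ddu[OF K(1)[OF r]]] by simp
    then show "(z has_real_derivative \<alpha> / u r - deriv u r / r) (at r within K)"
      by (rule has_field_derivative_at_within)
    have "\<bar>\<alpha> / u r - deriv u r / r\<bar> \<le> \<bar>\<alpha> / u r\<bar> + \<bar>deriv u r / r\<bar>" by (rule abs_triangle_ineq4)
    also have "\<bar>\<alpha> / u r\<bar> \<le> \<bar>\<alpha>\<bar> / (L/2)" 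
      unfolding abs_divide using K[OF r] L(1) by (intro divide_left_mono) auto
    also have "\<bar>deriv u r / r\<bar> \<le> 1 / (e/2)" 
      unfolding abs_divide using K[OF r] p J(5) by (intro frac_le) auto
    finally show "norm (\<alpha> / u r - deriv u r / r) \<le> B" by (simp add: B_def)
  qed (use that in auto)
  moreover have "B \<ge> 0" using L(1) J(5) by (simp add: B_def)
  ultimately have "B-lipschitz_on K z"
    by (intro lipschitz_onI) (auto simp: dist_norm)
  moreover have "e \<in> closure K"
    using J(3,5) d(1) unfolding K_def
    by (intro set_mp[OF open_Int_closure_subset[of "ball e (min d (e/2))" J, unfolded Int_commute[of _ J]]]) auto
  ultimately obtain l where l: "(z \<longlongrightarrow> l) (at e within K)"
    using uniformly_continuous_on_extension_at_closure[OF lipschitz_on_uniformly_continuous] by blast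
  have "at e within K = at e within J"
    unfolding K_def by (rule at_within_nhd[where S = "ball e (min d (e/2))"]) (use d J in auto)
  with l have "((\<lambda>r. tanh (z r)) \<longlongrightarrow> tanh l) (at e within J)"
    by (auto intro!: tendsto_tanh)
  moreover have "\<forall>\<^sub>F r in at e within J. tanh (z r) = deriv u r"
    using J(1) slope_less by (auto simp: eventually_at_filter z_def tanh_artanh_real subset_iff)
  ultimately have "(deriv u \<longlongrightarrow> tanh l) (at e within J)" by (rule Lim_transform_eventually)
  moreover have "(tanh l)\<^sup>2 < 1" using tanh_real_bounds[of l] by (simp add: abs_square_less_1 abs_less_iff)
  ultimately show ?thesis using that by blast
qed

end

section \<open>Maximal solutions at positive ends\<close>

lemma at_within_Ioo:
  fixes a b :: real
  assumes "a < b"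
  shows "at b within {a<..<b} = at_left b" "at a within {a<..<b} = at_right a"
  by (rule at_within_nhd[where S = "{a<..}"]; use assms in auto)
    (rule at_within_nhd[where S = "{..<b}"]; use assms in auto)

text \<open>Maximality speaks of solutions on supersets of \<open>I\<close> only; a solution on an
  interval that merely overlaps \<open>I\<close> has to be joined to \<open>u\<close> before it can
  be compared.\<close>

lemma max_sol_not_extendable:
  assumes "is_max_sol \<alpha> u I" "is_sol \<alpha> w K" "I \<inter> K \<noteq> {}" "\<And>r. r \<in> I \<inter> K \<Longrightarrow> w r = u r"
  shows "K \<subseteq> I"
proof -
  have "is_sol \<alpha> (\<lambda>r. if r \<in> I then u r else w r) (I \<union> K)"
    using assms by (intro is_sol_Un) (auto simp: is_max_sol_def)
  moreover have "\<forall>r\<in>I. (if r \<in> I then u r else w r) = u r" by simp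
  ultimately have "I \<union> K = I" using assms(1) unfolding is_max_sol_def by blast
  then show ?thesis by auto
qed

lemma is_sol_isCont:
  assumes "is_sol \<alpha> v J" "c \<in> J"
  shows "isCont v c" "isCont (deriv v) c"
  using is_solD(4,5)[OF assms] by (auto intro: DERIV_isCont)

lemma max_sol_right_end:
  assumes max: "is_max_sol \<alpha> u I" and J: "c < b" "{c<..<b} \<subseteq> I" "b \<notin> I" "I \<subseteq> {..<b}"
  shows "(u \<longlongrightarrow> 0) (at_left b)"
proof -
  have sol: "is_sol \<alpha> u I" using max by (simp add: is_max_sol_def)
  interpret profile_solution \<alpha> u I by unfold_locales (rule sol)
  have F: "at b within {c<..<b} = at_left b" using J(1) by (rule at_within_Ioo)
  have cl: "b \<in> closure {c<..<b}" using J(1) by simp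
  have "(c + b) / 2 \<in> I" using J(1) by (intro set_mp[OF J(2)]) auto
  then have b: "b > 0" using pos(1)[of "(c + b) / 2"] J by auto
  obtain L where L: "0 \<le> L" "(u \<longlongrightarrow> L) (at_left b)"
    using u_limit[OF J(2) cl] F by auto
  have False if L_pos: "L > 0"
  proof -
    obtain p1 where p1: "p1\<^sup>2 < 1" "(deriv u \<longlongrightarrow> p1) (at_left b)"
      by (rule slope_limit[OF J(2) _ cl _ b L_pos L(2)[folded F]]) (auto simp: F convex_real_interval)
    \<comment> \<open>A local solution with the limiting data at \<open>b\<close>, of which only the
      part to the right of \<open>b\<close> is kept.\<close>
    obtain \<eta>' v where v: "\<eta>' > 0" "is_sol \<alpha> v {b-\<eta>'<..<b+\<eta>'}" "v b = L" "deriv v b = p1"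
      using is_sol_local[OF b L_pos p1(1)] by metis
    define \<eta> where "\<eta> = min \<eta>' (b - c)"
    have \<eta>: "\<eta> > 0" "\<eta> \<le> \<eta>'" "c \<le> b - \<eta>" using v(1) J(1) by (auto simp: \<eta>_def)
    have "(v \<longlongrightarrow> L) (at_right b)" "(deriv v \<longlongrightarrow> p1) (at_right b)"
      using is_sol_isCont[OF v(2), of b] v by (auto simp: isCont_def intro: tendsto_within_subset)
    moreover have "is_sol \<alpha> u {b-\<eta><..<b}"
      by (rule is_sol_subset[OF sol]) (use J \<eta> in \<open>auto simp: is_interval_connected_1 subset_iff\<close>)
    moreover have "is_sol \<alpha> v {b<..<b+\<eta>}"
      by (rule is_sol_subset[OF v(2)]) (use \<eta> in \<open>auto simp: is_interval_connected_1 subset_iff\<close>)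
    ultimately obtain w where w: "is_sol \<alpha> w {b-\<eta><..<b+\<eta>}" "\<forall>r<b. w r = u r"
      using is_sol_glue[OF _ _ \<eta>(1) b L(2) _ L_pos p1(2) _ p1(1)] by blast
    have "b - \<eta>/2 \<in> I \<inter> {b-\<eta><..<b+\<eta>}" using J \<eta> by (auto simp: subset_iff)
    then have "{b-\<eta><..<b+\<eta>} \<subseteq> I"
      by (intro max_sol_not_extendable[OF max w(1)]) (use w(2) J(4) in auto)
    then have "b \<in> I" using \<eta>(1) by (simp add: subset_iff)
    then show False using J(3) by simp
  qed
  then show ?thesis using L by force
qed

lemma max_sol_left_end:
  assumes max: "is_max_sol \<alpha> u I" and J: "a < d" "{a<..<d} \<subseteq> I" "a \<notin> I" "I \<subseteq> {a<..}" and a: "a > 0"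
  shows "(u \<longlongrightarrow> 0) (at_right a)"
proof -
  have sol: "is_sol \<alpha> u I" using max by (simp add: is_max_sol_def)
  interpret profile_solution \<alpha> u I by unfold_locales (rule sol)
  have F: "at a within {a<..<d} = at_right a" using J(1) by (rule at_within_Ioo)
  have cl: "a \<in> closure {a<..<d}" using J(1) by simp
  obtain L where L: "0 \<le> L" "(u \<longlongrightarrow> L) (at_right a)"
    using u_limit[OF J(2) cl] F by auto
  have False if L_pos: "L > 0"
  proof -
    obtain p1 where p1: "p1\<^sup>2 < 1" "(deriv u \<longlongrightarrow> p1) (at_right a)"
      by (rule slope_limit[OF J(2) _ cl _ a L_pos L(2)[folded F]]) (auto simp: F convex_real_interval)
    obtain \<eta>' v where v: "\<eta>' > 0" "is_sol \<alpha> v {a-\<eta>'<..<a+\<eta>'}" "v a = L" "deriv v a = p1"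
      using is_sol_local[OF a L_pos p1(1)] by metis
    define \<eta> where "\<eta> = min \<eta>' (d - a)"
    have \<eta>: "\<eta> > 0" "\<eta> \<le> \<eta>'" "a + \<eta> \<le> d" using v(1) J(1) by (auto simp: \<eta>_def)
    have "(v \<longlongrightarrow> L) (at_left a)" "(deriv v \<longlongrightarrow> p1) (at_left a)"
      using is_sol_isCont[OF v(2), of a] v by (auto simp: isCont_def intro: tendsto_within_subset)
    moreover have "is_sol \<alpha> u {a<..<a+\<eta>}"
      by (rule is_sol_subset[OF sol]) (use J \<eta> in \<open>auto simp: is_interval_connected_1 subset_iff\<close>)
    moreover have "is_sol \<alpha> v {a-\<eta><..<a}"
      by (rule is_sol_subset[OF v(2)]) (use \<eta> in \<open>auto simp: is_interval_connected_1 subset_iff\<close>)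
    ultimately obtain w where w: "is_sol \<alpha> w {a-\<eta><..<a+\<eta>}" "\<forall>r>a. w r = u r"
      using is_sol_glue[OF _ _ \<eta>(1) a _ L(2) L_pos _ p1(2) p1(1)] by blast
    have "a + \<eta>/2 \<in> I \<inter> {a-\<eta><..<a+\<eta>}" using J \<eta> by (auto simp: subset_iff)
    then have "{a-\<eta><..<a+\<eta>} \<subseteq> I"
      by (intro max_sol_not_extendable[OF max w(1)]) (use w(2) J(4) in auto)
    then have "a \<in> I" using \<eta>(1) by (simp add: subset_iff)
    then show False using J(3) by simp
  qed
  then show ?thesis using L by force
qed

section \<open>Monotonicity of the flux\<close>

text \<open>Adding \<open>\<delta> * ln (x - a)\<close> to \<open>f\<close> gives a nonincreasing
  function, so \<open>f\<close> dominates a constant minus this logarithm. Every logarithmic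
  divergence below rests on this comparison: that of \<open>S\<close> at a positive end, and those
  of \<open>sg\<close> and \<open>V\<close> at the origin.\<close>

lemma filterlim_at_top_of_deriv_le:
  fixes f :: "real \<Rightarrow> real"
  assumes "a < d" "\<delta> > 0"
    and f: "\<And>x. a < x \<Longrightarrow> x \<le> d \<Longrightarrow> (f has_real_derivative f' x) (at x) \<and> f' x \<le> - \<delta> / (x - a)"
  shows "filterlim f at_top (at_right a)"
proof (rule filterlim_at_top_mono)
  show "filterlim (\<lambda>x. (f d + \<delta> * ln (d - a)) + - \<delta> * ln (x - a)) at_top (at_right a)"
    using \<open>\<delta> > 0\<close> by real_asymp
  have "f x \<ge> (f d + \<delta> * ln (d - a)) + - \<delta> * ln (x - a)" if x: "a < x" "x \<le> d" for x
  proof -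
    have "f d + \<delta> * ln (d - a) \<le> f x + \<delta> * ln (x - a)"
    proof (rule DERIV_nonpos_imp_nonincreasing[OF x(2)])
      fix y assume y: "x \<le> y" "y \<le> d"
      have "((\<lambda>x. f x + \<delta> * ln (x - a)) has_real_derivative f' y + \<delta> / (y - a)) (at y)"
        using f[of y] x y by (auto intro!: derivative_eq_intros)
      moreover have "f' y + \<delta> / (y - a) \<le> 0" using f[of y] x y by simp
      ultimately show "\<exists>z. ((\<lambda>x. f x + \<delta> * ln (x - a)) has_real_derivative z) (at y) \<and> z \<le> 0" by blast
    qed
    then show ?thesis by simp
  qed
  then show "\<forall>\<^sub>F x in at_right a. f x \<ge> (f d + \<delta> * ln (d - a)) + - \<delta> * ln (x - a)"
    using \<open>a < d\<close> by (auto simp: eventually_at_right intro!: exI[of _ d])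
qed

lemma filterlim_at_bot_of_deriv_le:
  fixes f :: "real \<Rightarrow> real"
  assumes "d < b" "\<delta> > 0"
    and f: "\<And>x. d \<le> x \<Longrightarrow> x < b \<Longrightarrow> (f has_real_derivative f' x) (at x) \<and> f' x \<le> - \<delta> / (b - x)"
  shows "filterlim f at_bot (at_left b)"
proof -
  have "filterlim (\<lambda>x. - f (- x)) at_top (at_right (- b))"
  proof (rule filterlim_at_top_of_deriv_le[of "-b" "-d" \<delta>])
    fix x assume "- b < x" "x \<le> - d"
    then have x: "(f has_real_derivative f' (- x)) (at (- x))" "f' (- x) \<le> - \<delta> / (b + x)"
      using f[of "-x"] by auto
    from x(1) have "((\<lambda>x. - f (- x)) has_real_derivative f' (- x)) (at x)"
      using DERIV_minus[OF x(1)[unfolded DERIV_mirror]] by simp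
    then show "((\<lambda>x. - f (- x)) has_real_derivative f' (- x)) (at x) \<and> f' (- x) \<le> - \<delta> / (x - - b)"
      using x(2) by (simp add: add.commute)
  qed (use assms in auto)
  then have "filterlim (\<lambda>x. - f x) at_top (at_left b)"
    by (simp add: filterlim_at_left_to_right)
  then show ?thesis by (simp add: filterlim_uminus_at_bot)
qed

text \<open>What matters is whether the function stays away from 0, because \<open>S\<close> will be
  divided by \<open>r\<close>; its limit may be minus infinity, hence eventual bounds in the first
  two cases. A negative value persists to the left. Without one, either there is a positive lower
  bound or the values come down to 0.\<close>

lemma mono_trichotomy_at_right_0:
  fixes f :: "real \<Rightarrow> real"
  assumes "d > 0" and mono: "\<And>x y. 0 < x \<Longrightarrow> x \<le> y \<Longrightarrow> y < d \<Longrightarrow> f x \<le> f y"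
  obtains k where "k > 0" "\<forall>\<^sub>F x in at_right 0. k \<le> f x"
    | k where "k > 0" "\<forall>\<^sub>F x in at_right 0. f x \<le> - k"
    | "(f \<longlongrightarrow> 0) (at_right 0)"
proof -
  let ?A = "\<exists>x>0. x < d \<and> f x < 0" and ?B = "\<exists>k>0. \<forall>x>0. x < d \<longrightarrow> k \<le> f x"
  consider ?A | "\<not> ?A" ?B | "\<not> ?A" "\<not> ?B" by blast
  then show ?thesis
  proof cases
    case 1
    then obtain x where x: "0 < x" "x < d" "f x < 0" by auto
    have "\<forall>\<^sub>F y in at_right 0. f y \<le> - (- f x)"
      unfolding eventually_at_right[OF x(1)] using mono x by (intro exI[of _ x]) auto
    then show ?thesis using that(2)[of "- f x"] x by auto
  next
    case 2
    then obtain k where "k > 0" "\<forall>x>0. x < d \<longrightarrow> k \<le> f x" by blast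
    then show ?thesis using that(1)[of k] \<open>d > 0\<close> by (auto simp: eventually_at_right)
  next
    case 3
    have "(f \<longlongrightarrow> 0) (at_right 0)"
    proof (rule order_tendstoI)
      fix k :: real assume "k < 0"
      have "k < f y" if "0 < y" "y < d" for y
      proof -
        have "\<not> f y < 0" using 3(1) that by blast
        then show ?thesis using \<open>k < 0\<close> by linarith
      qed
      then show "\<forall>\<^sub>F x in at_right 0. k < f x"
        unfolding eventually_at_right[OF \<open>d > 0\<close>] using \<open>d > 0\<close> by blast
    next
      fix k :: real assume "0 < k"
      then obtain x where x: "0 < x" "x < d" "f x < k" using 3(2) by (auto simp: not_le)
      then show "\<forall>\<^sub>F y in at_right 0. f y < k"
        unfolding eventually_at_right[OF \<open>d > 0\<close>]
        using mono[OF _ less_imp_le, of _ x] by (intro exI[of _ x]) (auto intro: le_less_trans)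
    qed
    then show ?thesis using that(3) by auto
  qed
qed

context profile_solution begin

text \<open>
  If $u' = \tanh z$, then \<open>sg\<close> is $\sinh z$ and \<open>S\<close> is $r \sinh z$. The point of the
  factor $r$ is that the derivative \<open>Sd\<close> of \<open>S\<close> has the sign of $\alpha$.
\<close>

definition sg where "sg r = deriv u r / sqrt (1 - (deriv u r)\<^sup>2)"
definition S where "S r = r * sg r"
definition Sd where "Sd r = \<alpha> * r / (u r * sqrt (1 - (deriv u r)\<^sup>2))"

lemma root_bounds:
  assumes "r \<in> I"
  shows "0 < sqrt (1 - (deriv u r)\<^sup>2)" "sqrt (1 - (deriv u r)\<^sup>2) \<le> 1"
  using slope_bounds[OF assms] by auto

text \<open>Both sides are cosh z, where u' = tanh z.\<close>

lemma one_plus_sg: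
  assumes "r \<in> I"
  shows "sqrt (1 + (sg r)\<^sup>2) = 1 / sqrt (1 - (deriv u r)\<^sup>2)"
proof -
  have "1 + (sg r)\<^sup>2 = 1 / (1 - (deriv u r)\<^sup>2)"
    using slope_bounds[OF assms] by (simp add: sg_def power_divide divide_simps)
  then show ?thesis by (simp add: real_sqrt_divide)
qed

lemma slope_eq: "r \<in> I \<Longrightarrow> deriv u r = sg r / sqrt (1 + (sg r)\<^sup>2)"
  using root_bounds(1)[of r] by (simp add: one_plus_sg) (simp add: sg_def)

text \<open>With u' = tanh z the equation reads z' = \<alpha> / u - u' / r, so sinh z has derivative
  z' cosh z, and cosh z is the reciprocal of the root.\<close>

lemma dsg:
  assumes "r \<in> I"
  shows "(sg has_real_derivative (\<alpha> / u r - deriv u r / r) / sqrt (1 - (deriv u r)\<^sup>2)) (at r)"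
proof -
  define s p k where "s = sqrt (1 - (deriv u r)\<^sup>2)" and "p = deriv u r" and "k = \<alpha> / u r - deriv u r / r"
  have s: "s > 0" "1 - p\<^sup>2 = s\<^sup>2" using slope_bounds[OF assms] by (auto simp: s_def p_def)
  have d: "(deriv u has_real_derivative s\<^sup>2 * k) (at r)"
    using ddu[OF assms] s by (simp add: p_def k_def)
  have "((\<lambda>r. 1 - (deriv u r)\<^sup>2) has_real_derivative - (2 * p * (s\<^sup>2 * k))) (at r)"
    by (auto intro!: derivative_eq_intros d simp: p_def)
  from DERIV_chain2[OF DERIV_real_sqrt this]
  have "((\<lambda>r. sqrt (1 - (deriv u r)\<^sup>2)) has_real_derivative - (p * (s\<^sup>2 * k)) / s) (at r)"
    using slope_bounds[OF assms] by (simp add: s_def inverse_eq_divide)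
  from DERIV_divide[OF d this]
  have "(sg has_real_derivative (s\<^sup>2 * k * s - p * (- (p * (s\<^sup>2 * k)) / s)) / (s * s)) (at r)"
    using s(1) by (simp add: sg_def[abs_def] s_def p_def)
  also have "(s\<^sup>2 * k * s - p * (- (p * (s\<^sup>2 * k)) / s)) / (s * s) = (s\<^sup>2 + p\<^sup>2) * k / s"
    using s(1) by (simp add: field_simps power2_eq_square)
  also have "s\<^sup>2 + p\<^sup>2 = 1" using s(2) by simp
  finally show ?thesis by (simp add: s_def k_def)
qed

text \<open>In the product rule, \<open>r\<close> times the term with \<open>deriv u r / r\<close>
  in the derivative of \<open>sg\<close> cancels \<open>sg r\<close>, and the term with
  \<open>\<alpha>\<close> is all that remains.\<close>

lemma dS:
  assumes "r \<in> I"
  shows "(S has_real_derivative Sd r) (at r)"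
proof -
  have "(S has_real_derivative sg r + (\<alpha> / u r - deriv u r / r) / sqrt (1 - (deriv u r)\<^sup>2) * r) (at r)"
    unfolding S_def[abs_def] using dsg[OF assms] by (auto intro!: derivative_eq_intros)
  moreover have "(\<alpha> / u r - deriv u r / r) * r = \<alpha> * r / u r - deriv u r"
    using pos(1)[OF assms] by (simp add: field_simps)
  then have "sg r + (\<alpha> / u r - deriv u r / r) / sqrt (1 - (deriv u r)\<^sup>2) * r = Sd r"
    unfolding times_divide_eq_left sg_def Sd_def by (simp flip: add_divide_distrib)
  ultimately show ?thesis by simp
qed

lemma S_sign:
  assumes "r \<in> I"
  shows "S r > 0 \<longleftrightarrow> deriv u r > 0" "S r < 0 \<longleftrightarrow> deriv u r < 0" "S r = 0 \<longleftrightarrow> deriv u r = 0"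
  using pos(1)[OF assms] root_bounds(1)[OF assms] slope_bounds[OF assms]
  by (auto simp: S_def sg_def zero_less_mult_iff mult_less_0_iff zero_less_divide_iff divide_less_0_iff)

text \<open>The root lies between 0 and 1, so dropping it can only shrink the modulus of
  \<open>Sd\<close>. The resulting bound involves \<open>u\<close> but no longer the slope.\<close>

lemma Sd_ge: "\<alpha> > 0 \<Longrightarrow> r \<in> I \<Longrightarrow> \<alpha> * r / u r \<le> Sd r"
  using pos[of r] root_bounds[of r] unfolding Sd_def by (intro divide_left_mono) (auto simp: mult_le_cancel_left1)

lemma Sd_le: "\<alpha> < 0 \<Longrightarrow> r \<in> I \<Longrightarrow> Sd r \<le> \<alpha> * r / u r"
  using pos[of r] root_bounds[of r] unfolding Sd_def
  by (intro divide_left_mono_neg) (auto simp: mult_le_cancel_left1 mult_less_0_iff mult_le_0_iff)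

lemma S_strict_mono:
  assumes "\<alpha> > 0" "x \<in> I" "y \<in> I" "x < y"
  shows "S x < S y"
proof (rule DERIV_pos_imp_increasing[OF assms(4)])
  fix r assume "x \<le> r" "r \<le> y"
  then have r: "r \<in> I" using I_between assms by blast
  have "0 < \<alpha> * r / u r" using pos[OF r] assms(1) by simp
  then have "0 < Sd r" using Sd_ge[OF assms(1) r] by linarith
  then show "\<exists>z. (S has_real_derivative z) (at r) \<and> 0 < z" using dS[OF r] by blast
qed

lemma S_strict_antimono:
  assumes "\<alpha> < 0" "x \<in> I" "y \<in> I" "x < y"
  shows "S y < S x"
proof (rule DERIV_neg_imp_decreasing[OF assms(4)])
  fix r assume "x \<le> r" "r \<le> y"
  then have r: "r \<in> I" using I_between assms by blast
  have "\<alpha> * r / u r < 0" using pos[OF r] assms(1) by (simp add: divide_neg_pos mult_neg_pos)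
  then have "Sd r < 0" using Sd_le[OF assms(1) r] by linarith
  then show "\<exists>z. (S has_real_derivative z) (at r) \<and> z < 0" using dS[OF r] by blast
qed

text \<open>The sign of \<open>S\<close> is asked for on the open interval, so that an end may be
  the critical point.\<close>

lemma u_strict_mono:
  assumes "x \<in> I" "y \<in> I" "x < y" "\<And>r. x < r \<Longrightarrow> r < y \<Longrightarrow> S r > 0"
  shows "u x < u y"
proof (rule DERIV_pos_imp_increasing_open[OF assms(3)])
  fix r assume r: "x < r" "r < y"
  then have "r \<in> I" using I_between[OF assms(1,2)] by simp
  then show "\<exists>z. (u has_real_derivative z) (at r) \<and> 0 < z" using du assms(4)[OF r] S_sign by blast
next
  show "continuous_on {x..y} u" 
    using du I_between[OF assms(1,2)] by (intro DERIV_atLeastAtMost_imp_continuous_on) auto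
qed

lemma u_strict_antimono:
  assumes "x \<in> I" "y \<in> I" "x < y" "\<And>r. x < r \<Longrightarrow> r < y \<Longrightarrow> S r < 0"
  shows "u y < u x"
proof (rule DERIV_neg_imp_decreasing_open[OF assms(3)])
  fix r assume r: "x < r" "r < y"
  then have "r \<in> I" using I_between[OF assms(1,2)] by simp
  then show "\<exists>z. (u has_real_derivative z) (at r) \<and> z < 0" using du assms(4)[OF r] S_sign by blast
next
  show "continuous_on {x..y} u" 
    using du I_between[OF assms(1,2)] by (intro DERIV_atLeastAtMost_imp_continuous_on) auto
qed

lemma u_le_dist:
  assumes lim: "(u \<longlongrightarrow> 0) (at e within J)" and "J \<subseteq> I" "at e within J \<noteq> bot" and r: "r \<in> I"
  shows "u r \<le> \<bar>r - e\<bar>"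
proof -
  have "((\<lambda>x. u x + \<bar>r - x\<bar>) \<longlongrightarrow> 0 + \<bar>r - e\<bar>) (at e within J)"
    by (intro tendsto_intros lim)
  moreover have "\<forall>\<^sub>F x in at e within J. u r \<le> u x + \<bar>r - x\<bar>"
    unfolding eventually_at_filter
  proof (intro always_eventually allI impI)
    fix x assume "x \<in> J"
    then show "u r \<le> u x + \<bar>r - x\<bar>" using u_lipschitz[OF r, of x] assms(2) by auto
  qed
  ultimately show ?thesis using tendsto_lowerbound assms(3) by fastforce
qed

lemma slope_tendsto:
  assumes ev: "\<forall>\<^sub>F r in F. r \<in> I"
  shows "filterlim sg at_top F \<Longrightarrow> (deriv u \<longlongrightarrow> 1) F"
    "filterlim sg at_bot F \<Longrightarrow> (deriv u \<longlongrightarrow> -1) F"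
    "(sg \<longlongrightarrow> 0) F \<Longrightarrow> (deriv u \<longlongrightarrow> 0) F"
proof -
  let ?g = "\<lambda>s::real. s / sqrt (1 + s\<^sup>2)"
  have *: "(deriv u \<longlongrightarrow> c) F" if "((\<lambda>r. ?g (sg r)) \<longlongrightarrow> c) F" for c
    using that by (rule Lim_transform_eventually) (use ev in \<open>auto elim!: eventually_mono simp: slope_eq\<close>)
  have top: "(?g \<longlongrightarrow> 1) at_top" by real_asymp
  show "filterlim sg at_top F \<Longrightarrow> (deriv u \<longlongrightarrow> 1) F" by (rule *[OF filterlim_compose[OF top]])
  have bot: "(?g \<longlongrightarrow> -1) at_bot" by real_asymp
  show "filterlim sg at_bot F \<Longrightarrow> (deriv u \<longlongrightarrow> -1) F" by (rule *[OF filterlim_compose[OF bot]])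
  have "1 + s\<^sup>2 \<noteq> 0" for s :: real by (smt (verit) zero_le_power2)
  then show "(sg \<longlongrightarrow> 0) F \<Longrightarrow> (deriv u \<longlongrightarrow> 0) F" 
    by (intro *) (auto intro!: tendsto_eq_intros)
qed

end

section \<open>Linear comparison, and the shape of open intervals\<close>

lemma deriv_ge_imp_growth:
  fixes f :: "real \<Rightarrow> real"
  assumes "x \<le> y" "\<And>r. x \<le> r \<Longrightarrow> r \<le> y \<Longrightarrow> (f has_real_derivative f' r) (at r) \<and> k \<le> f' r"
  shows "f x + k * (y - x) \<le> f y"
proof -
  have "f x - k * x \<le> f y - k * y"
  proof (rule DERIV_nonneg_imp_nondecreasing[OF assms(1)])
    fix r assume r: "x \<le> r" "r \<le> y"
    have "((\<lambda>r. f r - k * r) has_real_derivative f' r - k) (at r)"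
      using assms(2)[OF r] by (auto intro!: derivative_eq_intros)
    moreover have "0 \<le> f' r - k" using assms(2)[OF r] by simp
    ultimately show "\<exists>z. ((\<lambda>r. f r - k * r) has_real_derivative z) (at r) \<and> 0 \<le> z" by blast
  qed
  then show ?thesis by (simp add: algebra_simps)
qed

lemma deriv_le_imp_decay:
  fixes f :: "real \<Rightarrow> real"
  assumes "x \<le> y" "\<And>r. x \<le> r \<Longrightarrow> r \<le> y \<Longrightarrow> (f has_real_derivative f' r) (at r) \<and> f' r \<le> - k"
  shows "f y \<le> f x - k * (y - x)"
proof -
  have "- f x + k * (y - x) \<le> - f y"
  proof (rule deriv_ge_imp_growth[where f' = "\<lambda>r. - f' r", OF assms(1)])
    fix r assume "x \<le> r" "r \<le> y"
    then show "((\<lambda>r. - f r) has_real_derivative - f' r) (at r) \<and> k \<le> - f' r"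
      using assms(2)[of r] by (auto intro: DERIV_minus)
  qed
  then show ?thesis by simp
qed

lemma open_interval_cases:
  fixes I :: "real set"
  assumes "open I" "is_interval I" "I \<noteq> {}" "I \<subseteq> {0<..}"
  obtains a where "0 \<le> a" "I = {a<..}" | a b where "0 \<le> a" "a < b" "I = {a<..<b}"
proof -
  define a where "a = Inf I"
  have bd: "bdd_below I" using assms(4) by (force intro: bdd_belowI[where m = 0])
  have a: "0 \<le> a" unfolding a_def using assms(3,4) by (intro cInf_greatest) auto
  have gt: "a < x" if x: "x \<in> I" for x
  proof -
    obtain e where e: "e > 0" "ball x e \<subseteq> I" using assms(1) x by (auto simp: open_contains_ball)
    then have "x - e/2 \<in> I" by (auto simp: subset_iff dist_real_def)
    then have "a \<le> x - e/2" unfolding a_def using bd by (rule cInf_lower)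
    then show ?thesis using e by simp
  qed
  have ex: "\<exists>y\<in>I. y < x" if "a < x" for x
    using that assms(3) bd unfolding a_def by (simp add: cInf_less_iff)
  show ?thesis
  proof (cases "bdd_above I")
    case False
    have "x \<in> I" if x: "a < x" for x
    proof -
      obtain y where "y \<in> I" "y < x" using ex[OF x] by blast
      moreover obtain z where "z \<in> I" "x < z"
        using False by (force simp: bdd_above_def not_le)
      ultimately show ?thesis using assms(2) unfolding is_interval_1 by (blast intro: less_imp_le)
    qed
    then have "I = {a<..}" using gt by auto
    then show ?thesis using that(1) a by blast
  next
    case True
    define b where "b = Sup I"
    have lt: "x < b" if x: "x \<in> I" for x
    proof -
      obtain e where e: "e > 0" "ball x e \<subseteq> I" using assms(1) x by (auto simp: open_contains_ball)
      then have "x + e/2 \<in> I" by (auto simp: subset_iff dist_real_def)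
      then have "x + e/2 \<le> b" unfolding b_def using True by (rule cSup_upper)
      then show ?thesis using e by simp
    qed
    have "x \<in> I" if x: "a < x" "x < b" for x
    proof -
      obtain y where "y \<in> I" "y < x" using ex[OF x(1)] by blast
      moreover obtain z where "z \<in> I" "x < z"
        using x(2) assms(3) True unfolding b_def by (auto simp: less_cSup_iff)
      ultimately show ?thesis using assms(2) unfolding is_interval_1 by (blast intro: less_imp_le)
    qed
    then have "I = {a<..<b}" using gt lt by auto
    moreover from this have "a < b" using assms(3) by auto
    ultimately show ?thesis using that(2) a by blast
  qed
qed

section \<open>Flux and slope where the solution vanishes, and at the origin\<close>

context profile_solution begin

lemma S_left_end:
  assumes a: "0 < a" "a < d" "{a<..<d} \<subseteq> I" and lim: "(u \<longlongrightarrow> 0) (at_right a)"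
  shows "\<alpha> > 0 \<Longrightarrow> filterlim S at_bot (at_right a)" "\<alpha> < 0 \<Longrightarrow> filterlim S at_top (at_right a)"
proof -
  \<comment> \<open>The logarithmic comparison includes its far end, and \<open>d\<close> itself
    need not lie in \<open>I\<close>.\<close>
  define c where "c = (a + d) / 2"
  have c: "a < c" "c < d" using a by (auto simp: c_def)
  have I: "r \<in> I" if "a < r" "r \<le> c" for r using a(3) that c by auto
  have u: "u r \<le> r - a" if "a < r" "r \<le> c" for r
    using u_le_dist[of a "{a<..<d}" r] lim a I that by (simp add: at_within_Ioo)
  \<comment> \<open>Bounding the numerator \<open>r\<close> below by \<open>a\<close> is where
    \<open>a > 0\<close> enters; it yields the rate \<open>\<alpha> * a\<close> in modulus.\<close>
  have q: "a / (r - a) \<le> r / u r" if "a < r" "r \<le> c" for r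
    using u[OF that] pos[OF I[OF that]] that a by (intro frac_le) auto
  show "filterlim S at_bot (at_right a)" if "\<alpha> > 0"
  proof -
    have "filterlim (\<lambda>r. - S r) at_top (at_right a)"
    proof (rule filterlim_at_top_of_deriv_le[OF c(1), of "\<alpha> * a" _ "\<lambda>r. - Sd r"])
      show "\<alpha> * a > 0" using that a by simp
      fix r assume r: "a < r" "r \<le> c"
      have "\<alpha> * (a / (r - a)) \<le> \<alpha> * (r / u r)" using q[OF r] that by (intro mult_left_mono) auto
      then have "\<alpha> * a / (r - a) \<le> Sd r" using Sd_ge[OF that I[OF r]] by simp
      then show "((\<lambda>r. - S r) has_real_derivative - Sd r) (at r) \<and> - Sd r \<le> - (\<alpha> * a) / (r - a)"
        using dS[OF I[OF r]] by (auto intro: DERIV_minus)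
    qed
    then show ?thesis by (simp add: filterlim_uminus_at_bot)
  qed
  show "filterlim S at_top (at_right a)" if "\<alpha> < 0"
  proof (rule filterlim_at_top_of_deriv_le[OF c(1), of "- \<alpha> * a" _ "Sd"])
    show "- \<alpha> * a > 0" using that a by (simp add: mult_neg_pos)
    fix r assume r: "a < r" "r \<le> c"
    have "\<alpha> * (r / u r) \<le> \<alpha> * (a / (r - a))" using q[OF r] that by (intro mult_left_mono_neg) auto
    then have "Sd r \<le> \<alpha> * a / (r - a)" using Sd_le[OF that I[OF r]] by simp
    then show "(S has_real_derivative Sd r) (at r) \<and> Sd r \<le> - (- \<alpha> * a) / (r - a)"
      using dS[OF I[OF r]] by auto
  qed
qed

lemma S_right_end:
  assumes a: "a < b" "{a<..<b} \<subseteq> I" and lim: "(u \<longlongrightarrow> 0) (at_left b)"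
  shows "\<alpha> > 0 \<Longrightarrow> filterlim S at_top (at_left b)" "\<alpha> < 0 \<Longrightarrow> filterlim S at_bot (at_left b)"
proof -
  define c where "c = (a + b) / 2"
  have c: "a < c" "c < b" using a by (auto simp: c_def)
  have I: "r \<in> I" if "c \<le> r" "r < b" for r using a(2) that c by auto
  have c0: "c > 0" using I[of c] c pos(1) by blast
  have u: "u r \<le> b - r" if "c \<le> r" "r < b" for r
    using u_le_dist[of b "{a<..<b}" r] lim a I that by (simp add: at_within_Ioo)
  \<comment> \<open>The lower bound for \<open>r\<close> is \<open>c\<close> and not
    \<open>a\<close>, since \<open>a\<close> may be 0.\<close>
  have q: "c / (b - r) \<le> r / u r" if "c \<le> r" "r < b" for r
    using u[OF that] pos[OF I[OF that]] that c0 by (intro frac_le) auto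
  show "filterlim S at_bot (at_left b)" if "\<alpha> < 0"
  proof (rule filterlim_at_bot_of_deriv_le[OF c(2), of "- \<alpha> * c" _ "Sd"])
    show "- \<alpha> * c > 0" using that c0 by (simp add: mult_neg_pos)
    fix r assume r: "c \<le> r" "r < b"
    have "\<alpha> * (r / u r) \<le> \<alpha> * (c / (b - r))" using q[OF r] that by (intro mult_left_mono_neg) auto
    then have "Sd r \<le> \<alpha> * c / (b - r)" using Sd_le[OF that I[OF r]] by simp
    then show "(S has_real_derivative Sd r) (at r) \<and> Sd r \<le> - (- \<alpha> * c) / (b - r)"
      using dS[OF I[OF r]] by auto
  qed
  show "filterlim S at_top (at_left b)" if "\<alpha> > 0"
  proof -
    have "filterlim (\<lambda>r. - S r) at_bot (at_left b)"
    proof (rule filterlim_at_bot_of_deriv_le[OF c(2), of "\<alpha> * c" _ "\<lambda>r. - Sd r"])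
      show "\<alpha> * c > 0" using that c0 by simp
      fix r assume r: "c \<le> r" "r < b"
      have "\<alpha> * (c / (b - r)) \<le> \<alpha> * (r / u r)" using q[OF r] that by (intro mult_left_mono) auto
      then have "\<alpha> * c / (b - r) \<le> Sd r" using Sd_ge[OF that I[OF r]] by simp
      then show "((\<lambda>r. - S r) has_real_derivative - Sd r) (at r) \<and> - Sd r \<le> - (\<alpha> * c) / (b - r)"
        using dS[OF I[OF r]] by (auto intro: DERIV_minus)
    qed
    then show ?thesis by (simp add: filterlim_uminus_at_top)
  qed
qed

text \<open>A function that decreases away from the limit 0 cannot be positive. This excludes
  positive left ends when \<alpha> > 0, and a zero limit at the origin with negative flux when
  \<alpha> < 0.\<close>

lemma vanishing_left_end_slope:
  assumes a: "a < d" "{a<..<d} \<subseteq> I" and lim: "(u \<longlongrightarrow> 0) (at_right a)" 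
  shows "\<not> (\<forall>\<^sub>F r in at_right a. S r < 0)"
proof
  assume "\<forall>\<^sub>F r in at_right a. S r < 0"
  then obtain e where e: "a < e" "\<And>r. a < r \<Longrightarrow> r < e \<Longrightarrow> S r < 0"
    unfolding eventually_at_right[OF a(1)] by blast
  define c where "c = (a + min d e) / 2"
  have c: "a < c" "c < d" "c < e" using a e by (auto simp: c_def min_def)
  have "c \<in> I" using a c by auto
  have "\<forall>\<^sub>F r in at_right a. u c \<le> u r"
    unfolding eventually_at_right[OF c(1)]
  proof (intro exI[of _ c] conjI allI impI c(1))
    fix r assume "a < r" "r < c"
    then show "u c \<le> u r" using a c e(2) by (intro less_imp_le u_strict_antimono) auto
  qed
  then have "u c \<le> 0" by (rule tendsto_lowerbound[OF lim]) simp
  then show False using pos(2)[OF \<open>c \<in> I\<close>] by simp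
qed

lemma vanishing_right_end_slope:
  assumes a: "a < b" "{a<..<b} \<subseteq> I" and lim: "(u \<longlongrightarrow> 0) (at_left b)" 
  shows "\<not> (\<forall>\<^sub>F r in at_left b. S r > 0)"
proof
  assume "\<forall>\<^sub>F r in at_left b. S r > 0"
  then obtain e where e: "e < b" "\<And>r. e < r \<Longrightarrow> r < b \<Longrightarrow> S r > 0"
    unfolding eventually_at_left[OF a(1)] by blast
  define c where "c = (b + max a e) / 2"
  have c: "c < b" "a < c" "e < c" using a e by (auto simp: c_def max_def)
  have "c \<in> I" using a c by auto
  have "\<forall>\<^sub>F r in at_left b. u c \<le> u r"
    unfolding eventually_at_left[OF c(1)]
  proof (intro exI[of _ c] conjI allI impI c(1))
    fix r assume "c < r" "r < b"
    then show "u c \<le> u r" using a c e(2) by (intro less_imp_le u_strict_mono) auto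
  qed
  then have "u c \<le> 0" by (rule tendsto_lowerbound[OF lim]) simp
  then show False using pos(2)[OF \<open>c \<in> I\<close>] by simp
qed

text \<open>Bounds on sinh z are turned into bounds on tanh z. If the slope is below 1/2 in modulus,
  the root is at least 1/2 and \<open>sg\<close> is at most twice the slope in modulus; otherwise
  1/2 itself serves as the bound.\<close>

lemma slope_ge:
  assumes "r \<in> I" "\<kappa> > 0"
  shows "\<kappa> \<le> sg r \<Longrightarrow> min (1/2) (\<kappa>/2) \<le> deriv u r" "sg r \<le> - \<kappa> \<Longrightarrow> deriv u r \<le> - min (1/2) (\<kappa>/2)"
proof -
  have *: "\<bar>sg r\<bar> \<le> 2 * \<bar>deriv u r\<bar>" if "\<bar>deriv u r\<bar> < 1/2"
  proof -
    have "(deriv u r)\<^sup>2 \<le> (1/2)\<^sup>2" using that by (intro power2_le_iff_abs_le[THEN iffD2]) auto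
    then have "sqrt ((1/2)\<^sup>2) \<le> sqrt (1 - (deriv u r)\<^sup>2)" by (intro real_sqrt_le_mono) (simp add: power2_eq_square)
    then have "1/2 \<le> sqrt (1 - (deriv u r)\<^sup>2)" by simp
    then have "\<bar>deriv u r\<bar> / sqrt (1 - (deriv u r)\<^sup>2) \<le> \<bar>deriv u r\<bar> / (1/2)"
      using slope_less[OF assms(1)] by (intro divide_left_mono) auto
    then show ?thesis using root_bounds[OF assms(1)] by (simp add: sg_def abs_divide)
  qed
  have s: "sg r > 0 \<longleftrightarrow> deriv u r > 0" "sg r < 0 \<longleftrightarrow> deriv u r < 0"
    using root_bounds[OF assms(1)] by (auto simp: sg_def zero_less_divide_iff divide_less_0_iff)
  show "min (1/2) (\<kappa>/2) \<le> deriv u r" if "\<kappa> \<le> sg r" using * s assms(2) that by (smt (verit) field_sum_of_halves)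
  show "deriv u r \<le> - min (1/2) (\<kappa>/2)" if "sg r \<le> - \<kappa>" using * s assms(2) that by (smt (verit) field_sum_of_halves)
qed

lemma slope_limit_of_S:
  assumes d: "d > 0" "{0<..<d} \<subseteq> I"
  shows "k > 0 \<Longrightarrow> \<forall>\<^sub>F r in at_right 0. k \<le> S r \<Longrightarrow> (deriv u \<longlongrightarrow> 1) (at_right 0)"
    "k > 0 \<Longrightarrow> \<forall>\<^sub>F r in at_right 0. S r \<le> - k \<Longrightarrow> (deriv u \<longlongrightarrow> -1) (at_right 0)"
    "(S \<longlongrightarrow> 0) (at_right 0) \<Longrightarrow> L > 0 \<Longrightarrow> (u \<longlongrightarrow> L) (at_right 0) \<Longrightarrow> (deriv u \<longlongrightarrow> 0) (at_right 0)"
proof -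
  have evI: "\<forall>\<^sub>F r in at_right 0. r \<in> I"
    unfolding eventually_at_right[OF d(1)] using d by (intro exI[of _ d]) auto
  have ev0: "\<forall>\<^sub>F r in at_right 0. (0::real) < r" by (simp add: eventually_at_right_less)
  have sg: "sg r = S r / r" if "0 < r" for r using that by (simp add: S_def)
  show "(deriv u \<longlongrightarrow> 1) (at_right 0)" if k: "k > 0" "\<forall>\<^sub>F r in at_right 0. k \<le> S r"
  proof (rule slope_tendsto(1)[OF evI])
    have "filterlim (\<lambda>r. k / r) at_top (at_right 0)" using k(1) by real_asymp
    moreover have "\<forall>\<^sub>F r in at_right 0. k / r \<le> sg r"
      using k(2) ev0 by eventually_elim (simp add: sg divide_right_mono)
    ultimately show "filterlim sg at_top (at_right 0)" by (rule filterlim_at_top_mono)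
  qed
  show "(deriv u \<longlongrightarrow> -1) (at_right 0)" if k: "k > 0" "\<forall>\<^sub>F r in at_right 0. S r \<le> - k"
  proof (rule slope_tendsto(2)[OF evI])
    have "filterlim (\<lambda>r. k / r) at_top (at_right 0)" using k(1) by real_asymp
    moreover have "\<forall>\<^sub>F r in at_right 0. k / r \<le> - sg r"
      using k(2) ev0
    proof eventually_elim
      case (elim r)
      then have "k / r \<le> (- S r) / r" by (intro divide_right_mono) auto
      then show ?case using elim by (simp add: sg)
    qed
    ultimately have "filterlim (\<lambda>r. - sg r) at_top (at_right 0)" by (rule filterlim_at_top_mono)
    then show "filterlim sg at_bot (at_right 0)" by (simp add: filterlim_uminus_at_bot)
  qed
  show "(deriv u \<longlongrightarrow> 0) (at_right 0)" if S: "(S \<longlongrightarrow> 0) (at_right 0)" and L: "L > 0" "(u \<longlongrightarrow> L) (at_right 0)"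
  proof (rule slope_tendsto(3)[OF evI])
    \<comment> \<open>\<open>Sd\<close> is rewritten through r cosh z =
      \<open>sqrt (r\<^sup>2 + (S r)\<^sup>2)\<close>. In this form its limit follows from those of
      \<open>S\<close> and \<open>u\<close>, without knowing that the slope stays away from 1 in
      modulus.\<close>
    have Sd: "Sd r = \<alpha> * sqrt (r\<^sup>2 + (S r)\<^sup>2) / u r" if "r \<in> I" for r
    proof -
      have "r\<^sup>2 + (S r)\<^sup>2 = r\<^sup>2 * (1 + (sg r)\<^sup>2)" by (simp add: S_def power_mult_distrib distrib_left)
      then have "sqrt (r\<^sup>2 + (S r)\<^sup>2) = r / sqrt (1 - (deriv u r)\<^sup>2)"
        using one_plus_sg[OF that] pos(1)[OF that] by (simp add: real_sqrt_mult)
      then show ?thesis by (simp add: Sd_def mult.commute)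
    qed
    have "((\<lambda>r. \<alpha> * sqrt (r\<^sup>2 + (S r)\<^sup>2) / u r) \<longlongrightarrow> \<alpha> * sqrt (0\<^sup>2 + 0\<^sup>2) / L) (at_right 0)"
      using L by (intro tendsto_intros S) auto
    then have "((\<lambda>r. \<alpha> * sqrt (r\<^sup>2 + (S r)\<^sup>2) / u r / 1) \<longlongrightarrow> 0) (at_right 0)" by simp
    then have lim: "((\<lambda>r. Sd r / 1) \<longlongrightarrow> 0) (at_right 0)"
      by (rule Lim_transform_eventually) (use evI in \<open>auto elim!: eventually_mono simp: Sd\<close>)
    have "((\<lambda>r. S r / r) \<longlongrightarrow> 0) (at_right 0)"
    proof (rule lhopital_right_0[OF S _ _ _ _ _ lim])
      show "\<forall>\<^sub>F r in at_right 0. (S has_real_derivative Sd r) (at r)"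
        using evI by (rule eventually_mono) (rule dS)
    qed (use ev0 in \<open>auto elim!: eventually_mono intro: tendsto_eq_intros\<close>)
    then show "(sg \<longlongrightarrow> 0) (at_right 0)"
      by (rule Lim_transform_eventually) (use ev0 in \<open>auto elim!: eventually_mono simp: sg\<close>)
  qed
qed

end

section \<open>Solutions starting at the origin\<close>

text \<open>Gibbs' inequality for two-point distributions with weights \<open>(1 - c) / 2\<close>
  and \<open>(1 + c) / 2\<close>: the two linear bounds from ln x \<le> x - 1 cancel. It says that
  the slope part of \<open>V\<close> below is minimal at slope \<open>c\<close>.\<close>

lemma cross_entropy_le:
  fixes c p :: real
  assumes "0 < c" "c < 1" "-1 < p" "p < 1"
  shows "(1 - c) / 2 * ln (1 - p) + (1 + c) / 2 * ln (1 + p) \<le>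
    (1 - c) / 2 * ln (1 - c) + (1 + c) / 2 * ln (1 + c)"
proof -
  have "(1 - c) / 2 * ln ((1 - p) / (1 - c)) \<le> (1 - c) / 2 * ((1 - p) / (1 - c) - 1)"
    using assms by (intro mult_left_mono ln_le_minus_one) auto
  also have "\<dots> = (c - p) / 2" using assms by (simp add: field_simps)
  finally have 1: "(1 - c) / 2 * (ln (1 - p) - ln (1 - c)) \<le> (c - p) / 2" using assms by (simp add: ln_div)
  have "(1 + c) / 2 * ln ((1 + p) / (1 + c)) \<le> (1 + c) / 2 * ((1 + p) / (1 + c) - 1)"
    using assms by (intro mult_left_mono ln_le_minus_one) auto
  also have "\<dots> = (p - c) / 2" using assms by (simp add: field_simps)
  finally have 2: "(1 + c) / 2 * (ln (1 + p) - ln (1 + c)) \<le> (p - c) / 2" using assms by (simp add: ln_div)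
  show ?thesis using add_mono[OF 1 2] by (simp add: right_diff_distrib add_divide_distrib diff_divide_distrib)
qed

text \<open>The vertex case. If \<open>S\<close> also tends to 0, then \<open>Sd\<close> is of the
  form 0/0 at the origin and monotonicity of the flux does not determine the slope.\<close>

locale vanishing_at_origin = profile_solution +
  assumes \<alpha>: "\<alpha> > 0" and I: "I = {0<..}" and S_pos: "\<And>r. 0 < r \<Longrightarrow> S r > 0"
    and u_0: "(u \<longlongrightarrow> 0) (at_right 0)"
begin

lemma slope_pos: "0 < r \<Longrightarrow> deriv u r > 0"
  using S_pos[of r] S_sign(1)[of r] by (simp add: I)

lemma u_le: "0 < r \<Longrightarrow> u r \<le> r"
  using u_le_dist[of 0 "{0<..}" r] u_0 by (simp add: I)

text \<open>The slope bound is integrated from \<open>e > 0\<close> to \<open>r\<close>, and then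
  \<open>e\<close> tends to 0, where \<open>u\<close> vanishes.\<close>

lemma u_mult_bounds:
  assumes "0 < r"
  shows "(\<And>x. 0 < x \<Longrightarrow> x \<le> r \<Longrightarrow> deriv u x \<le> q) \<Longrightarrow> u r \<le> q * r"
    "(\<And>x. 0 < x \<Longrightarrow> x \<le> r \<Longrightarrow> q \<le> deriv u x) \<Longrightarrow> q * r \<le> u r"
proof -
  have ev: "\<forall>\<^sub>F e in at_right 0. 0 < e \<and> e \<le> r"
    unfolding eventually_at_right[OF assms] using assms by (intro exI[of _ r]) auto
  have lim: "((\<lambda>e. u e + q * (r - e)) \<longlongrightarrow> 0 + q * (r - 0)) (at_right 0)"
    by (intro tendsto_intros u_0)
  show "u r \<le> q * r" if q: "\<And>x. 0 < x \<Longrightarrow> x \<le> r \<Longrightarrow> deriv u x \<le> q"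
  proof -
    have "u r \<le> u e + q * (r - e)" if e: "0 < e \<and> e \<le> r" for e
      using deriv_le_imp_decay[of e r u "deriv u" "-q"] du q e by (force simp: I)
    then have "\<forall>\<^sub>F e in at_right 0. u r \<le> u e + q * (r - e)"
      by (intro eventually_mono[OF ev])
    then show ?thesis using tendsto_lowerbound[OF lim] by simp
  qed
  show "q * r \<le> u r" if q: "\<And>x. 0 < x \<Longrightarrow> x \<le> r \<Longrightarrow> q \<le> deriv u x"
  proof -
    have "u e + q * (r - e) \<le> u r" if e: "0 < e \<and> e \<le> r" for e
      using deriv_ge_imp_growth[of e r u "deriv u" q] du q e by (force simp: I)
    then have "\<forall>\<^sub>F e in at_right 0. u e + q * (r - e) \<le> u r"
      by (intro eventually_mono[OF ev])
    then show ?thesis using tendsto_upperbound[OF lim] by simp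
  qed
qed

text \<open>A bootstrap. If \<alpha> \<ge> 1, then u \<le> r makes the slope nondecreasing, hence at
  most \<open>q < 1\<close> on (0, 1]. This improves the bound to u \<le> q r, so that \<alpha> / u
  - u' / r \<ge> (1 / q - q) / r, and \<open>sg\<close> tends to minus infinity at the origin,
  against \<open>S > 0\<close>.\<close>

lemma \<alpha>_less_1: "\<alpha> < 1"
proof (rule ccontr)
  assume "\<not> \<alpha> < 1"
  then have \<alpha>1: "1 \<le> \<alpha>" by simp
  define q where "q = deriv u 1"
  have q: "0 < q" "q < 1" using slope_pos[of 1] slope_bounds[of 1] by (auto simp: q_def I)
  have pq: "deriv u x \<le> q" if "0 < x" "x \<le> 1" for x
    unfolding q_def
  proof (rule DERIV_nonneg_imp_nondecreasing[OF that(2)])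
    fix r assume "x \<le> r" "r \<le> 1"
    then have r: "r \<in> I" "r > 0" using that by (auto simp: I)
    have "deriv u r / r \<le> 1 / r" using slope_bounds[OF r(1)] r by (intro divide_right_mono) auto
    also have "\<dots> \<le> \<alpha> / u r" using u_le[OF r(2)] pos[OF r(1)] \<alpha>1 by (intro frac_le) auto
    finally have "0 \<le> (1 - (deriv u r)\<^sup>2) * (\<alpha> / u r - deriv u r / r)"
      using slope_bounds[OF r(1)] by simp
    then show "\<exists>y. (deriv u has_real_derivative y) (at r) \<and> 0 \<le> y" using ddu[OF r(1)] by blast
  qed
  define \<delta> where "\<delta> = 1 / q - q"
  have "q * q < 1 * 1" using q by (intro mult_strict_mono) auto
  then have \<delta>: "\<delta> > 0" using q by (simp add: \<delta>_def field_simps)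
  have "filterlim (\<lambda>r. - sg r) at_top (at_right 0)"
  proof (rule filterlim_at_top_of_deriv_le[OF zero_less_one \<delta>])
    fix r :: real assume r0: "0 < r" "r \<le> 1"
    then have r: "r \<in> I" by (simp add: I)
    let ?k = "\<alpha> / u r - deriv u r / r"
    have "u r \<le> q * r" using r0 pq by (intro u_mult_bounds) auto
    then have "1 / (q * r) \<le> \<alpha> / u r" using pos[OF r] \<alpha>1 by (intro frac_le) auto
    moreover have "deriv u r / r \<le> q / r" using pq[OF r0] r0 by (intro divide_right_mono) auto
    ultimately have k: "\<delta> / r \<le> ?k" by (simp add: \<delta>_def diff_divide_distrib)
    have "?k \<ge> 0" using k \<delta> r0 by (smt (verit) divide_pos_pos)
    then have "?k / 1 \<le> ?k / sqrt (1 - (deriv u r)\<^sup>2)"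
      using root_bounds[OF r] by (intro divide_left_mono) auto
    then have "\<delta> / r \<le> ?k / sqrt (1 - (deriv u r)\<^sup>2)" using k by simp
    then show "((\<lambda>r. - sg r) has_real_derivative - (?k / sqrt (1 - (deriv u r)\<^sup>2))) (at r) \<and>
      - (?k / sqrt (1 - (deriv u r)\<^sup>2)) \<le> - \<delta> / (r - 0)"
      using dsg[OF r] by (auto intro: DERIV_minus)
  qed
  then have "\<forall>\<^sub>F r in at_right 0. 0 < - sg r" unfolding filterlim_at_top_dense by blast
  moreover have "\<forall>\<^sub>F r in at_right 0. 0 < sg r"
    using eventually_at_right_less[of 0]
  proof eventually_elim
    case (elim r)
    then show ?case using S_pos[of r] by (simp add: S_def zero_less_mult_iff)
  qed
  ultimately have "\<forall>\<^sub>F r in at_right (0::real). False" by eventually_elim simp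
  then show False by simp
qed

text \<open>
  The equation is invariant under scaling: for $w = u / r$, $p = u'$ and $c = \sqrt\alpha$ it is
  the autonomous system $r w' = p - w$, $r p' = (1 - p^2) (c^2 / w - p)$ with the single rest point
  $w = p = c$. The function $V$ decreases along its orbits with rate $D$, which vanishes only there.
\<close>

definition w where "w r = u r / r"
definition c where "c = sqrt \<alpha>"
definition D where "D r = (deriv u r - c)\<^sup>2 + c / w r * (w r - c)\<^sup>2"
definition V where "V r = - ((1 - c) / 2 * ln (1 - deriv u r) + (1 + c) / 2 * ln (1 + deriv u r))
  + c * w r - c\<^sup>2 * ln (w r)"

lemma c: "0 < c" "c < 1" "c\<^sup>2 = \<alpha>"
  using \<alpha> \<alpha>_less_1 by (auto simp: c_def)

lemma w: "0 < r \<Longrightarrow> 0 < w r" "0 < r \<Longrightarrow> w r \<le> 1"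
  using u_le[of r] pos(2)[of r] by (auto simp: w_def I)

lemma D_nonneg: "0 < r \<Longrightarrow> 0 \<le> D r"
  using w[of r] c by (simp add: D_def)

text \<open>\<open>V\<close> is a function of p plus a function of w, with derivatives (p - c) / (1
  - p^2) and c - c^2 / w. The first denominator absorbs the factor 1 - p^2 of p'. After writing c^2
  / w - p as (c - p) + c (c - w) / w, the products of p - c and w - c cancel and minus
  \<open>D\<close> is left.\<close>

lemma dV:
  assumes "0 < r"
  shows "(V has_real_derivative - D r / r) (at r)"
proof -
  define p k where "p = deriv u r" and "k = c\<^sup>2 / w r - p"
  have rI: "r \<in> I" using assms by (simp add: I)
  have p: "-1 < p" "p < 1" "1 - p\<^sup>2 > 0" using slope_bounds[OF rI] by (auto simp: p_def)
  have w0: "w r > 0" using w assms by auto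
  have "\<alpha> / u r - p / r = k / r" using assms by (simp add: k_def w_def c(3) diff_divide_distrib)
  then have d: "(deriv u has_real_derivative (1 - p\<^sup>2) * (k / r)) (at r)"
    using ddu[OF rI] by (simp add: p_def)
  have dw: "(w has_real_derivative (p - w r) / r) (at r)"
    unfolding w_def[abs_def] using du[OF rI] assms
    by (auto intro!: derivative_eq_intros simp: p_def field_simps)
  have alg: "- ((1 - c) / 2 * (- ((1 - p) * (1 + p) * q) / (1 - p)) + (1 + c) / 2 * ((1 - p) * (1 + p) * q / (1 + p)))
     = (p - c) * q" for q
  proof -
    have "- ((1 - p) * (1 + p) * q) / (1 - p) = - ((1 + p) * q)" "(1 - p) * (1 + p) * q / (1 + p) = (1 - p) * q"
      using p by (simp_all add: divide_simps)
    then show ?thesis by (simp only:) (simp add: field_simps)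
  qed
  have "(V has_real_derivative - ((1 - c) / 2 * (- ((1 - p\<^sup>2) * (k / r)) / (1 - p))
      + (1 + c) / 2 * ((1 - p\<^sup>2) * (k / r) / (1 + p))) + c * ((p - w r) / r) - c\<^sup>2 * ((p - w r) / r / w r)) (at r)"
    unfolding V_def[abs_def]
  proof (intro DERIV_add DERIV_diff DERIV_minus DERIV_cmult dw)
    show "((\<lambda>r. ln (1 - deriv u r)) has_real_derivative - ((1 - p\<^sup>2) * (k / r)) / (1 - p)) (at r)"
      using p by (auto intro!: derivative_eq_intros d simp flip: p_def)
    show "((\<lambda>r. ln (1 + deriv u r)) has_real_derivative (1 - p\<^sup>2) * (k / r) / (1 + p)) (at r)"
      using p by (auto intro!: derivative_eq_intros d simp flip: p_def)
    show "((\<lambda>r. ln (w r)) has_real_derivative (p - w r) / r / w r) (at r)"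
      using w0 by (auto intro!: derivative_eq_intros dw)
  qed
  also have "(1 - p\<^sup>2) = (1 - p) * (1 + p)" by (simp add: power2_eq_square algebra_simps)
  also have "- ((1 - c) / 2 * (- ((1 - p) * (1 + p) * (k / r)) / (1 - p)) + (1 + c) / 2 * ((1 - p) * (1 + p) * (k / r) / (1 + p)))
     = (p - c) * (k / r)" by (rule alg)
  also have "(p - c) * (k / r) + c * ((p - w r) / r) - c\<^sup>2 * ((p - w r) / r / w r)
     = ((p - c) * k + (c - c\<^sup>2 / w r) * (p - w r)) / r"
    using assms w0 by (simp add: field_simps)
  also have "(p - c) * k + (c - c\<^sup>2 / w r) * (p - w r) = - D r"
    unfolding D_def k_def p_def[symmetric] using w0 by (simp add: field_simps power2_eq_square)
  finally show ?thesis .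
qed

lemma V_antimono:
  assumes "0 < x" "x \<le> y"
  shows "V y \<le> V x"
proof (rule DERIV_nonpos_imp_nonincreasing[OF assms(2)])
  fix r assume "x \<le> r" "r \<le> y"
  then have r: "0 < r" using assms by auto
  then have "- D r / r \<le> 0" using D_nonneg[OF r] by simp
  then show "\<exists>z. (V has_real_derivative z) (at r) \<and> z \<le> 0" using dV[OF r] by blast
qed

text \<open>
  A small $w(r)$ makes $S$ grow so much on $[r/2, r]$ that the slope at $r$ exceeds $P$.
\<close>

lemma V_bound:
  assumes P: "0 < P" "P < 1"
  obtains B where "\<And>r. 0 < r \<Longrightarrow> deriv u r < P \<Longrightarrow> V r \<le> B"
proof -
  define K where "K = P / sqrt (1 - P\<^sup>2)"
  have P2: "0 < 1 - P\<^sup>2" using P by (simp add: abs_square_less_1)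
  have K: "K > 0" using P P2 by (simp add: K_def)
  define m where "m = \<alpha> / (4 * K)"
  have m: "m > 0" using \<alpha> K by (simp add: m_def)
  have wm: "m \<le> w r" if r: "0 < r" "deriv u r < P" for r
  proof -
    have rI: "r \<in> I" "r/2 \<in> I" using r by (auto simp: I)
    have "(deriv u r)\<^sup>2 \<le> P\<^sup>2" using r slope_pos[OF r(1)] by (intro power_mono) auto
    then have "sg r \<le> K" unfolding sg_def K_def
      using r P P2 slope_pos[OF r(1)] by (intro frac_le) (auto intro: less_imp_le)
    then have SK: "S r \<le> r * K" using r by (simp add: S_def)
    \<comment> \<open>As \<open>u\<close> increases, the flux grows on [r/2, r] at least at the rate
      \<open>\<alpha> * (r/2) / u r\<close>. Over the length r/2 this makes
      \<open>r * (\<alpha> / (4 * w r))\<close>, against the cap \<open>r * K\<close>; hence the 4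
      in \<open>m\<close>.\<close>
    have "S (r/2) + \<alpha> * (r/2) / u r * (r - r/2) \<le> S r"
    proof (rule deriv_ge_imp_growth)
      fix x assume x: "r/2 \<le> x" "x \<le> r"
      then have xI: "x \<in> I" using r by (auto simp: I)
      have "u x \<le> u r" 
        using x xI rI S_pos by (cases "x = r") (auto intro!: less_imp_le u_strict_mono simp: I)
      then have "\<alpha> * (r/2) / u r \<le> \<alpha> * x / u x"
        using x r \<alpha> pos[OF xI] by (intro frac_le mult_left_mono) auto
      also have "\<dots> \<le> Sd x" by (rule Sd_ge[OF \<alpha> xI])
      finally show "(S has_real_derivative Sd x) (at x) \<and> \<alpha> * (r/2) / u r \<le> Sd x" using dS[OF xI] by simp
    qed (use r in auto)
    then have "\<alpha> * (r/2) / u r * (r/2) \<le> r * K" using S_pos[of "r/2"] SK r by simp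
    moreover have "\<alpha> * (r/2) / u r * (r/2) = r * (\<alpha> / (4 * w r))" using r by (simp add: w_def)
    ultimately have "\<alpha> / (4 * w r) \<le> K" using r by (simp only: mult_le_cancel_left_pos)
    then show ?thesis using w(1)[OF r(1)] K by (simp add: m_def field_simps)
  qed
  \<comment> \<open>\<open>V\<close> can become large only through slope near 1 or \<open>w\<close>
    near 0; the bounds \<open>P\<close> and \<open>m\<close> exclude both.\<close>
  have "V r \<le> - ((1 - c) / 2 * ln (1 - P)) + c - c\<^sup>2 * ln m" if r: "0 < r" "deriv u r < P" for r
  proof -
    have "(1 - c) / 2 * ln (1 - P) \<le> (1 - c) / 2 * ln (1 - deriv u r)"
      using r c P by (intro mult_left_mono) auto
    moreover have "0 \<le> (1 + c) / 2 * ln (1 + deriv u r)" using c slope_pos[OF r(1)] by simp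
    moreover have "c * w r \<le> c" using c w[OF r(1)] by simp
    moreover have "c\<^sup>2 * ln m \<le> c\<^sup>2 * ln (w r)" using m wm[OF r] by (intro mult_left_mono) auto
    ultimately show ?thesis unfolding V_def by linarith
  qed
  then show ?thesis using that by blast
qed

text \<open>Integrating the slope bound gives u \<ge> P r, hence \<alpha> / u - u' / r \<le>
  (\<alpha> / P - P) / r. The numerator is negative because \<open>P\<close> exceeds the slope of
  the cone, so \<open>sg\<close> diverges logarithmically to plus infinity.\<close>

lemma slope_to_1:
  assumes P: "0 < P" "P\<^sup>2 > \<alpha>" and d: "d > 0" "\<And>r. 0 < r \<Longrightarrow> r < d \<Longrightarrow> P \<le> deriv u r"
  shows "(deriv u \<longlongrightarrow> 1) (at_right 0)"
proof (rule slope_tendsto(1))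
  show "\<forall>\<^sub>F r in at_right 0. r \<in> I" by (simp add: I eventually_at_right_less)
  define \<delta> where "\<delta> = P - \<alpha> / P"
  have \<delta>: "\<delta> > 0" using P by (simp add: \<delta>_def field_simps power2_eq_square)
  have d2: "0 < d/2" using d(1) by simp
  show "filterlim sg at_top (at_right 0)"
  proof (rule filterlim_at_top_of_deriv_le[OF d2 \<delta>])
    fix r assume r0: "0 < r" "r \<le> d/2"
    then have r: "r \<in> I" "r < d" using d(1) by (auto simp: I)
    let ?k = "\<alpha> / u r - deriv u r / r"
    have "P * r \<le> u r" using r0 r d(2) by (intro u_mult_bounds) auto
    then have "\<alpha> / u r \<le> \<alpha> / (P * r)" using \<alpha> P r0 pos[OF r(1)] by (intro divide_left_mono) auto
    moreover have "P / r \<le> deriv u r / r" using d(2)[OF r0(1) r(2)] r0 by (intro divide_right_mono) auto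
    ultimately have k: "?k \<le> - \<delta> / r" by (simp add: \<delta>_def diff_divide_distrib)
    moreover have "- \<delta> / r < 0" using \<delta> r0 by simp
    ultimately have "?k / sqrt (1 - (deriv u r)\<^sup>2) \<le> ?k / 1"
      using root_bounds[OF r(1)] by (intro divide_left_mono_neg) auto
    then show "(sg has_real_derivative (?k / sqrt (1 - (deriv u r)\<^sup>2))) (at r) \<and>
      (?k / sqrt (1 - (deriv u r)\<^sup>2)) \<le> - \<delta> / (r - 0)"
      using dsg[OF r(1)] k by simp
  qed
qed

text \<open>If the slope keeps dropping below a threshold above that of the cone, \<open>V\<close>
  is bounded. Then \<open>D\<close> is small along a sequence tending to the origin, (w, p) tends to
  (c, c) along it, and \<open>V\<close> is bounded everywhere by its value at the rest point, which
  is its minimum.\<close>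

lemma cone_or_slope_1: "(\<forall>r>0. u r = sqrt \<alpha> * r) \<or> (deriv u \<longlongrightarrow> 1) (at_right 0)"
proof (cases "\<exists>d>0. \<forall>r. 0 < r \<and> r < d \<longrightarrow> sqrt ((1 + \<alpha>) / 2) \<le> deriv u r")
  case True
  then show ?thesis using slope_to_1[of "sqrt ((1 + \<alpha>) / 2)"] \<alpha> \<alpha>_less_1 by auto
next
  case False
  \<comment> \<open>The threshold satisfies \<alpha> < P^2 < 1: \<open>slope_to_1\<close> uses the
    first inequality, \<open>V_bound\<close> the second.\<close>
  define P where "P = sqrt ((1 + \<alpha>) / 2)"
  have P: "0 < P" "P < 1" using \<alpha> \<alpha>_less_1 by (auto simp: P_def)
  obtain B where B: "\<And>r. 0 < r \<Longrightarrow> deriv u r < P \<Longrightarrow> V r \<le> B" using V_bound[OF P] by blast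
  \<comment> \<open>There are slopes below \<open>P\<close> arbitrarily close to the origin; since
    \<open>V\<close> is nonincreasing, the bound at such points passes to every later
    \<open>r\<close>.\<close>
  have VB: "V r \<le> B" if r: "0 < r" for r
  proof -
    obtain x where "0 < x" "x < r" "deriv u x < P" using False r by (auto simp: P_def not_le)
    then show ?thesis using B[of x] V_antimono[of x r] by linarith
  qed
  \<comment> \<open>Were \<open>D\<close> bounded below by \<open>e\<close> near the origin, V' = -
    D / r would make \<open>V\<close> diverge there.\<close>
  have "\<exists>r. 0 < r \<and> r < e \<and> D r < e" if e: "e > 0" for e
  proof (rule ccontr)
    assume neg: "\<not> ?thesis"
    have e2: "0 < e / 2" using e by simp
    have "filterlim V at_top (at_right 0)"
    proof (rule filterlim_at_top_of_deriv_le[OF e2 e])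
      fix r assume r: "0 < r" "r \<le> e/2"
      then have "r < e" using e by linarith
      then have "e \<le> D r" using neg r(1) not_less by blast
      then show "(V has_real_derivative - D r / r) (at r) \<and> - D r / r \<le> - e / (r - 0)"
        using dV[OF r(1)] r by (simp add: divide_right_mono)
    qed
    then have "\<forall>\<^sub>F r in at_right 0. B < V r" by (simp add: filterlim_at_top_dense)
    moreover have "\<forall>\<^sub>F r in at_right 0. V r \<le> B"
      using eventually_at_right_less[of 0] by eventually_elim (rule VB)
    ultimately have "\<forall>\<^sub>F r in at_right (0::real). False" by eventually_elim simp
    then show False by simp
  qed
  then have "\<exists>r. 0 < r \<and> r < inverse (real (Suc n)) \<and> D r < inverse (real (Suc n))" for n by simp
  then obtain x where x: "\<And>n. 0 < x n" "\<And>n. x n < inverse (real (Suc n))" "\<And>n. D (x n) < inverse (real (Suc n))"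
    by metis
  have inv0: "(\<lambda>n. inverse (real (Suc n))) \<longlonglongrightarrow> 0" by (rule LIMSEQ_inverse_real_of_nat)
  have sq: "f \<longlonglongrightarrow> c" if f: "\<And>n. (f n - c)\<^sup>2 \<le> C * D (x n)" and C: "C > 0" for f :: "nat \<Rightarrow> real" and C
  proof -
    have "(\<lambda>n. (f n - c)\<^sup>2) \<longlonglongrightarrow> 0"
    proof (rule tendsto_sandwich[where f = "\<lambda>_. 0"])
      show "(\<lambda>n. C * inverse (real (Suc n))) \<longlonglongrightarrow> 0" using tendsto_mult_right_zero[OF inv0] .
      have "(f n - c)\<^sup>2 \<le> C * inverse (real (Suc n))" for n
        using f[of n] mult_left_mono[OF less_imp_le[OF x(3)[of n]], of C] C by linarith
      then show "\<forall>\<^sub>F n in sequentially. (f n - c)\<^sup>2 \<le> C * inverse (real (Suc n))" by simp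
    qed auto
    then have "(\<lambda>n. sqrt ((f n - c)\<^sup>2)) \<longlonglongrightarrow> sqrt 0" by (rule tendsto_real_sqrt)
    then have "(\<lambda>n. f n - c) \<longlonglongrightarrow> 0" by (simp add: tendsto_rabs_zero_iff)
    then show ?thesis by (simp add: LIM_zero_iff)
  qed
  have pc: "(\<lambda>n. deriv u (x n)) \<longlonglongrightarrow> c"
    using less_imp_le[OF w(1)[OF x(1)]] c(1) by (intro sq[of _ 1]) (auto simp: D_def)
  have wc: "(\<lambda>n. w (x n)) \<longlonglongrightarrow> c"
  proof (rule sq[of _ "1 / c"])
    fix n
    \<comment> \<open>As \<open>w\<close> is at most 1, the weight \<open>c / w\<close> in
      \<open>D\<close> is at least \<open>c\<close>; hence the constant
      \<open>1 / c\<close>.\<close>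
    have "c * (w (x n) - c)\<^sup>2 \<le> c / w (x n) * (w (x n) - c)\<^sup>2"
      using w[OF x(1)[of n]] c by (intro mult_right_mono) (auto simp: pos_le_divide_eq)
    also have "\<dots> \<le> D (x n)" by (simp add: D_def)
    finally show "(w (x n) - c)\<^sup>2 \<le> 1 / c * D (x n)" using c by (simp add: field_simps)
  qed (use c in auto)
  have "(\<lambda>n. V (x n)) \<longlonglongrightarrow> - ((1 - c) / 2 * ln (1 - c) + (1 + c) / 2 * ln (1 + c)) + c * c - c\<^sup>2 * ln c" (is "_ \<longlonglongrightarrow> ?V0")
    unfolding V_def using c by (intro tendsto_intros pc wc) auto
  then have V0: "V r \<le> ?V0" if r: "0 < r" for r
  proof (rule tendsto_lowerbound)
    have "\<forall>\<^sub>F n in sequentially. inverse (real (Suc n)) < r" using order_tendstoD(2)[OF inv0 r] .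
    then show "\<forall>\<^sub>F n in sequentially. V r \<le> V (x n)"
      by eventually_elim (use V_antimono x less_trans in \<open>blast intro: less_imp_le\<close>)
  qed simp
  have "u r = c * r" if r: "0 < r" for r
  proof -
    have "(1 - c) / 2 * ln (1 - deriv u r) + (1 + c) / 2 * ln (1 + deriv u r)
      \<le> (1 - c) / 2 * ln (1 - c) + (1 + c) / 2 * ln (1 + c)"
      using c slope_bounds[of r] r by (intro cross_entropy_le) (auto simp: I)
    \<comment> \<open>The slope part of \<open>V\<close> is minimal at \<open>c\<close>, so the
      bound by \<open>?V0\<close> passes to the part in \<open>w\<close> alone. The equality case of
      ln x \<le> x - 1 then forces \<open>w r = c\<close>.\<close>
    then have "c * w r - c\<^sup>2 * ln (w r) \<le> c * c - c\<^sup>2 * ln c" using V0[OF r] unfolding V_def by linarith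
    moreover have "c\<^sup>2 * (w r / c - 1) = c * w r - c * c" using c(1) by (simp add: field_simps power2_eq_square)
    ultimately have "c\<^sup>2 * (w r / c - 1) \<le> c\<^sup>2 * (ln (w r) - ln c)" by (simp only: right_diff_distrib)
    then have "w r / c - 1 \<le> ln (w r) - ln c" using c(1) by (simp only: mult_le_cancel_left_pos zero_less_power)
    then have "w r / c - 1 \<le> ln (w r / c)" using c w[OF r] by (simp add: ln_div)
    then have "ln (w r / c) = w r / c - 1" using ln_le_minus_one[of "w r / c"] c w[OF r] by simp
    then have "w r / c = 1" using ln_eq_minus_one[of "w r / c"] c w[OF r] by simp
    then show ?thesis using c r by (simp add: w_def field_simps)
  qed
  then show ?thesis by (simp add: c_def)
qed

end

section \<open>Classification\<close>

lemma max_sol_domain: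
  assumes max: "is_max_sol \<alpha> u I"
  obtains a where "0 \<le> a" "I = {a<..}" "a > 0 \<Longrightarrow> (u \<longlongrightarrow> 0) (at_right a)"
    | a b where "0 \<le> a" "a < b" "I = {a<..<b}" "a > 0 \<Longrightarrow> (u \<longlongrightarrow> 0) (at_right a)" "(u \<longlongrightarrow> 0) (at_left b)"
proof -
  have "open I" "is_interval I" "I \<noteq> {}" "I \<subseteq> {0<..}" using max by (auto simp: is_max_sol_def is_sol_def)
  then show ?thesis
  proof (cases rule: open_interval_cases)
    case (1 a)
    have "a > 0 \<Longrightarrow> (u \<longlongrightarrow> 0) (at_right a)"
      using 1 by (intro max_sol_left_end[OF max, of a "a + 1"]) auto
    then show ?thesis using that(1) 1 by blast
  next
    case (2 a b)
    have "a > 0 \<Longrightarrow> (u \<longlongrightarrow> 0) (at_right a)"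
      using 2 by (intro max_sol_left_end[OF max, of a b]) auto
    moreover have "(u \<longlongrightarrow> 0) (at_left b)"
      using 2 by (intro max_sol_right_end[OF max, of a b]) auto
    ultimately show ?thesis using that(2) 2 by blast
  qed
qed

text \<open>At a positive left end the flux would tend to minus infinity and \<open>u\<close> would
  decrease away from 0; at a right end it would tend to plus infinity and \<open>u\<close> would
  increase towards 0. Both contradict u > 0.\<close>

lemma max_sol_domain_pos:
  assumes max: "is_max_sol \<alpha> u I" and \<alpha>: "\<alpha> > 0"
  shows "I = {0<..}"
proof -
  interpret profile_solution \<alpha> u I using max by unfold_locales (simp add: is_max_sol_def)
  from max show ?thesis
  proof (cases rule: max_sol_domain)
    case (1 a)
    have "\<not> a > 0"
    proof
      assume a: "a > 0"
      then have "filterlim S at_bot (at_right a)"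
        using 1 \<alpha> by (intro S_left_end(1)[of a "a + 1"]) auto
      then have "\<forall>\<^sub>F r in at_right a. S r < 0" unfolding filterlim_at_bot_dense by blast
      moreover have "{a<..<a + 1} \<subseteq> I" using 1(2) by auto
      ultimately show False using vanishing_left_end_slope[OF _ _ 1(3)[OF a], of "a + 1"] by simp
    qed
    then show ?thesis using 1 by simp
  next
    case (2 a b)
    then have "filterlim S at_top (at_left b)"
      using \<alpha> by (intro S_right_end(1)[of a b]) auto
    then have "\<forall>\<^sub>F r in at_left b. 0 < S r" unfolding filterlim_at_top_dense by blast
    then show ?thesis using vanishing_right_end_slope[of a b] 2 by auto
  qed
qed

section \<open>Critical points and behaviour for large radius\<close>

context profile_solution begin

lemma S_zero_between:
  assumes "x \<in> I" "y \<in> I" "S x < 0" "0 < S y"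
  obtains c where "c \<in> I" "S c = 0"
proof -
  have "continuous_on I S"
    using dS by (auto intro!: continuous_at_imp_continuous_on DERIV_isCont)
  then have "is_interval (S ` I)"
    using I_interval by (auto simp: is_interval_connected_1 intro: connected_continuous_image)
  then have "0 \<in> S ` I" using assms unfolding is_interval_1 by (blast intro: less_imp_le)
  then show ?thesis using that by auto
qed

lemma S_zero_imp_min:
  assumes "\<alpha> > 0" "c \<in> I" "S c = 0" "r \<in> I"
  shows "u c \<le> u r"
proof -
  have S: "x \<in> I \<Longrightarrow> x < c \<Longrightarrow> S x < 0" "x \<in> I \<Longrightarrow> c < x \<Longrightarrow> 0 < S x" for x
    using S_strict_mono[OF assms(1)] assms(2,3) by force+
  consider "r < c" | "r = c" | "c < r" by linarith
  then show ?thesis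
  proof cases
    case 1
    then show ?thesis
      by (intro less_imp_le u_strict_antimono S) (use assms I_between[OF assms(4,2)] in auto)
  next
    case 3
    then show ?thesis
      by (intro less_imp_le u_strict_mono S) (use assms I_between[OF assms(2,4)] in auto)
  qed simp
qed

lemma S_zero_imp_max:
  assumes "\<alpha> < 0" "c \<in> I" "S c = 0" "r \<in> I"
  shows "u r \<le> u c"
proof -
  have S: "x \<in> I \<Longrightarrow> x < c \<Longrightarrow> 0 < S x" "x \<in> I \<Longrightarrow> c < x \<Longrightarrow> S x < 0" for x
    using S_strict_antimono[OF assms(1)] assms(2,3) by force+
  consider "r < c" | "r = c" | "c < r" by linarith
  then show ?thesis
  proof cases
    case 1
    then show ?thesis
      by (intro less_imp_le u_strict_mono S) (use assms I_between[OF assms(4,2)] in auto)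
  next
    case 3
    then show ?thesis
      by (intro less_imp_le u_strict_antimono S) (use assms I_between[OF assms(2,4)] in auto)
  qed simp
qed

text \<open>If the flux were never positive, \<open>u\<close> would decrease; then \<open>Sd\<close>
  would be at least \<open>\<alpha> / u 1\<close> beyond 1, and linear growth would carry
  \<open>S\<close> above 0.\<close>

lemma S_eventually_pos:
  assumes "\<alpha> > 0" "I = {0<..}"
  obtains r where "0 < r" "0 < S r"
proof -
  have False if neg: "\<And>r. 0 < r \<Longrightarrow> S r \<le> 0"
  proof -
    have S_neg: "S r < 0" if "0 < r" for r
      using S_strict_mono[OF assms(1), of r "r + 1"] neg[of "r + 1"] that assms(2) by simp
    define k where "k = \<alpha> / u 1"
    have u1: "u 1 > 0" using pos(2) assms(2) by simp
    then have k: "k > 0" using assms(1) by (simp add: k_def)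
    \<comment> \<open>Chosen so that the linear lower bound for \<open>S y\<close> equals
      \<open>k\<close>.\<close>
    define y where "y = 2 - S 1 / k"
    have y: "1 \<le> y" using S_neg[of 1] k by (simp add: y_def divide_neg_pos less_imp_le field_simps)
    have "S 1 + k * (y - 1) \<le> S y"
    proof (rule deriv_ge_imp_growth[OF y])
      fix r :: real assume r: "1 \<le> r" "r \<le> y"
      then have rI: "r \<in> I" using assms(2) by simp
      have "u r \<le> u 1"
        using r assms(2) S_neg by (cases "r = 1") (auto intro!: less_imp_le u_strict_antimono)
      then have "k * 1 \<le> \<alpha> / u r * r"
        unfolding k_def using assms(1) pos[OF rI] u1 r by (intro mult_mono divide_left_mono) auto
      also have "\<dots> \<le> Sd r" using Sd_ge[OF assms(1) rI] by simp
      finally show "(S has_real_derivative Sd r) (at r) \<and> k \<le> Sd r" using dS[OF rI] by simp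
    qed
    moreover have "S 1 + k * (y - 1) = k" using k by (simp add: y_def field_simps)
    ultimately show False using k neg[of y] y by simp
  qed
  then show ?thesis using that not_le by blast
qed

text \<open>As \<open>u\<close> is eventually increasing, it only has to be unbounded. Under a bound
  \<open>M\<close> the flux grows linearly, so S / r and with it the slope stay above a positive
  constant, and \<open>u\<close> passes \<open>M\<close>.\<close>

lemma u_at_top:
  assumes "\<alpha> > 0" "I = {0<..}"
  shows "filterlim u at_top at_top"
proof -
  obtain a where a: "0 < a" "0 < S a" using S_eventually_pos[OF assms] by blast
  have S_pos: "0 < S r" if "a \<le> r" for r
    using S_strict_mono[OF assms(1), of a r] a that assms(2) by (cases "a = r") auto
  have u_mono: "u x \<le> u y" if "a \<le> x" "x \<le> y" for x y
    using that a assms(2) S_pos by (cases "x = y") (auto intro!: less_imp_le u_strict_mono)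
  have ex: "\<exists>r\<ge>a. M \<le> u r" if M: "M > 0" for M
  proof (rule ccontr)
    assume "\<not> ?thesis"
    then have uM: "u r < M" if "a \<le> r" for r using that not_le by blast
    define k where "k = \<alpha> * a / M"
    have k: "k > 0" using assms a M by (simp add: k_def)
    have S_ge: "k * (r - a) \<le> S r" if "a \<le> r" for r
    proof -
      have "S a + k * (r - a) \<le> S r"
      proof (rule deriv_ge_imp_growth[OF that])
        fix x assume x: "a \<le> x" "x \<le> r"
        then have xI: "x \<in> I" using a assms(2) by simp
        have "k \<le> \<alpha> * x / u x"
          unfolding k_def using x uM[OF x(1)] assms(1) pos[OF xI] a by (intro frac_le mult_left_mono) auto
        also have "\<dots> \<le> Sd x" by (rule Sd_ge[OF assms(1) xI])
        finally show "(S has_real_derivative Sd x) (at x) \<and> k \<le> Sd x" using dS[OF xI] by simp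
      qed
      then show ?thesis using a by simp
    qed
    \<comment> \<open>One halving comes from \<open>x - a \<ge> x / 2\<close> beyond
      \<open>2 * a\<close>, the other from \<open>slope_ge\<close>.\<close>
    define \<kappa> where "\<kappa> = min (1/2) (k/2/2)"
    have \<kappa>: "\<kappa> > 0" using k by (simp add: \<kappa>_def)
    define y where "y = 2 * a + M / \<kappa>"
    have y: "2 * a \<le> y" using M \<kappa> by (simp add: y_def)
    have "u (2 * a) + \<kappa> * (y - 2 * a) \<le> u y"
    proof (rule deriv_ge_imp_growth[OF y])
      fix x assume x: "2 * a \<le> x" "x \<le> y"
      then have xI: "x \<in> I" using a assms(2) by simp
      have "k/2 * x \<le> k * (x - a)" using x k by (simp add: field_simps)
      also have "\<dots> \<le> sg x * x" using S_ge[of x] x a by (simp add: S_def mult.commute)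
      finally have "k/2 \<le> sg x" using pos(1)[OF xI] by (rule mult_right_le_imp_le)
      then have "\<kappa> \<le> deriv u x" unfolding \<kappa>_def using k by (intro slope_ge(1)[OF xI]) auto
      then show "(u has_real_derivative deriv u x) (at x) \<and> \<kappa> \<le> deriv u x" using du[OF xI] by simp
    qed
    moreover have "\<kappa> * (y - 2 * a) = M" using \<kappa> by (simp add: y_def)
    ultimately show False using uM[of y] y a pos(2)[of "2 * a"] assms(2) by simp
  qed
  show ?thesis
    unfolding filterlim_at_top
  proof
    fix Z :: real
    have "0 < max Z 1" by simp
    from ex[OF this] obtain r where r: "a \<le> r" "max Z 1 \<le> u r" by blast
    show "\<forall>\<^sub>F x in at_top. Z \<le> u x"
      using eventually_ge_at_top[of r]
    proof eventually_elim
      case (elim x)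
      then show ?case using u_mono[of r x] r by simp
    qed
  qed
qed

text \<open>The Lipschitz bound makes \<open>u\<close> at most linear, so \<open>Sd\<close> stays
  below a negative constant and \<open>S\<close> becomes negative. From then on \<open>u\<close>
  decreases, \<open>S\<close> falls at least linearly, and the slope stays below a negative
  constant, which takes \<open>u\<close> to 0 at a finite radius.\<close>

lemma domain_bounded:
  assumes "\<alpha> < 0"
  shows "I \<noteq> {a<..}"
proof
  assume I: "I = {a<..}"
  define a1 where "a1 = a + 1"
  have a1: "a1 \<in> I" "a1 > 0" using pos(1)[of a1] by (auto simp: I a1_def)
  have up: "r \<in> I" "r > 0" if "a1 \<le> r" for r using that a1 by (auto simp: I)
  obtain b where b: "a1 \<le> b" "S b < 0"
  proof -
    have False if nonneg: "\<And>r. a1 \<le> r \<Longrightarrow> 0 \<le> S r"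
    proof -
      \<comment> \<open>Beyond \<open>a1\<close> the Lipschitz bound \<open>u a1 + (r - a1)\<close>
        is at most \<open>C * r\<close>.\<close>
      define C where "C = 1 + u a1 / a1"
      have C: "C > 0" using pos[OF a1(1)] by (simp add: C_def add_pos_pos)
      define k where "k = - \<alpha> / C"
      have k: "k > 0" using assms C by (simp add: k_def divide_neg_pos)
      define y where "y = a1 + S a1 / k + 1"
      have y: "a1 \<le> y" using nonneg[of a1] k by (simp add: y_def)
      have "S y \<le> S a1 - k * (y - a1)"
      proof (rule deriv_le_imp_decay[OF y])
        fix r assume r: "a1 \<le> r" "r \<le> y"
        note rI = up[OF r(1)]
        have "u r \<le> u a1 + (r - a1)" using u_lipschitz[OF rI(1) a1(1)] r by linarith
        also have "u a1 \<le> u a1 / a1 * r" 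
          using mult_left_mono[OF r(1), of "u a1 / a1"] pos[OF a1(1)] by (simp add: less_imp_le)
        finally have "u r \<le> C * r" using a1 by (simp add: C_def distrib_right)
        then have "1 / C \<le> r / u r" using C pos[OF rI(1)] by (simp add: field_simps)
        then have "\<alpha> * (r / u r) \<le> \<alpha> * (1 / C)" using assms by (intro mult_left_mono_neg) auto
        then have "Sd r \<le> - k" using Sd_le[OF assms rI(1)] by (simp add: k_def)
        then show "(S has_real_derivative Sd r) (at r) \<and> Sd r \<le> - k" using dS[OF rI(1)] by simp
      qed
      moreover have "S a1 - k * (y - a1) = - k" using k by (simp add: y_def field_simps)
      ultimately show False using k nonneg[OF y] by simp
    qed
    then show ?thesis using that not_le by blast
  qed
  have b0: "b \<in> I" "b > 0" using up b by auto
  have S_neg: "S r < 0" if "b \<le> r" for r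
    using S_strict_antimono[OF assms, of b r] b that up by (cases "b = r") auto
  define k where "k = - \<alpha> * b / u b"
  have k: "k > 0" using assms pos(2)[OF b0(1)] b0 by (simp add: k_def divide_neg_pos mult_neg_pos)
  have S_le: "S r \<le> - k * (r - b)" if "b \<le> r" for r
  proof -
    have "S r \<le> S b - k * (r - b)"
    proof (rule deriv_le_imp_decay[OF that])
      fix x assume x: "b \<le> x" "x \<le> r"
      then have xI: "x \<in> I" "x > 0" using up[of x] b by auto
      have "u x \<le> u b"
        using x xI b0 S_neg by (cases "x = b") (auto intro!: less_imp_le u_strict_antimono)
      then have "b / u b \<le> x / u x" using x pos[OF xI(1)] by (intro frac_le) auto
      then have "\<alpha> * (x / u x) \<le> \<alpha> * (b / u b)" using assms by (intro mult_left_mono_neg) auto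
      then have "Sd x \<le> - k" using Sd_le[OF assms xI(1)] by (simp add: k_def)
      then show "(S has_real_derivative Sd x) (at x) \<and> Sd x \<le> - k" using dS[OF xI(1)] by simp
    qed
    then show ?thesis using b by simp
  qed
  define \<kappa> where "\<kappa> = min (1/2) (k/2/2)"
  have \<kappa>: "\<kappa> > 0" using k by (simp add: \<kappa>_def)
  \<comment> \<open>The radius at which the line of slope \<open>- \<kappa>\<close> through the
    value at \<open>2 * b\<close> reaches 0.\<close>
  define y where "y = 2 * b + u (2 * b) / \<kappa>"
  have b2: "2 * b \<in> I" using up(1)[of "2 * b"] b b0 by simp
  have y: "2 * b \<le> y" using pos(2)[OF b2] \<kappa> by (simp add: y_def)
  have "u y \<le> u (2 * b) - \<kappa> * (y - 2 * b)"
  proof (rule deriv_le_imp_decay[OF y])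
    fix x assume x: "2 * b \<le> x" "x \<le> y"
    then have xI: "x \<in> I" using up(1)[of x] b b0 by simp
    have "sg x * x \<le> - k * (x - b)" using S_le[of x] x b0 by (simp add: S_def mult.commute)
    also have "\<dots> \<le> - (k/2) * x" using x k by (simp add: field_simps)
    finally have "sg x \<le> - (k/2)" using pos(1)[OF xI] by (rule mult_right_le_imp_le)
    then have "deriv u x \<le> - \<kappa>" unfolding \<kappa>_def using k by (intro slope_ge(2)[OF xI]) auto
    then show "(u has_real_derivative deriv u x) (at x) \<and> deriv u x \<le> - \<kappa>" using du[OF xI] by simp
  qed
  then have "u y \<le> 0" using \<kappa> by (simp add: y_def)
  moreover have "y \<in> I" using up(1)[of y] y b b0 by simp
  ultimately show False using pos(2)[of y] by simp
qed

end

section \<open>Slope limits at the origin and at the ends\<close>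

lemma eventually_at_right_0_witness:
  fixes r :: real
  assumes "\<forall>\<^sub>F x in at_right 0. Q x" "0 < r"
  obtains x where "0 < x" "x < r" "Q x"
proof -
  have "\<forall>\<^sub>F x in at_right 0. 0 < x \<and> x < r"
    unfolding eventually_at_right[OF assms(2)] using assms(2) by blast
  from eventually_happens'[OF trivial_limit_at_right_real eventually_conj[OF this assms(1)]]
  show ?thesis using that by blast
qed

text \<open>The trichotomy applied to \<open>S\<close>. A flux that is negative near the origin
  becomes positive later, so it has a zero, unique by strict monotonicity. A flux tending to 0
  leaves the value of u(0+) to decide, and the vertex case is the only source of the cone.\<close>

lemma (in profile_solution) slope_at_origin_pos:
  assumes \<alpha>: "\<alpha> > 0" and I: "I = {0<..}"
  shows "\<exists>u0'. (deriv u \<longlongrightarrow> u0') (at_right 0) \<and>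
               ((u0' = 0 \<and> (\<forall>x\<in>I. \<forall>y\<in>I. x < y \<longrightarrow> u x < u y)) \<or>
                (u0' = -1 \<and> (\<exists>!c. c \<in> I \<and> deriv u c = 0) \<and>
                   (\<forall>c\<in>I. deriv u c = 0 \<longrightarrow> (\<forall>r\<in>I. u c \<le> u r))) \<or>
                (u0' = 1 \<and> (\<forall>x\<in>I. \<forall>y\<in>I. x < y \<longrightarrow> u x < u y)) \<or>
                (u0' = sqrt \<alpha> \<and> (\<forall>r\<in>I. u r = sqrt \<alpha> * r)))"
proof -
  have incr: "\<forall>x\<in>I. \<forall>y\<in>I. x < y \<longrightarrow> u x < u y" if "\<And>r. 0 < r \<Longrightarrow> 0 < S r"
  proof (intro ballI impI)
    fix x y assume "x \<in> I" "y \<in> I" "x < y"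
    then show "u x < u y" by (intro u_strict_mono that) (simp_all add: I)
  qed
  have sub: "{0<..<1} \<subseteq> I" by (auto simp: I)
  have mono: "S x \<le> S y" if "0 < x" "x \<le> y" for x y
    using S_strict_mono[OF \<alpha>, of x y] that by (cases "x = y") (auto simp: I)
  from mono have mono': "\<And>x y. 0 < x \<Longrightarrow> x \<le> y \<Longrightarrow> y < 1 \<Longrightarrow> S x \<le> S y" by blast
  have small: "\<exists>x>0. x < r \<and> Q x" if "\<forall>\<^sub>F x in at_right 0. Q x" "0 < r" for Q and r :: real
    using eventually_at_right_0_witness[OF that] by blast
  show ?thesis
  proof (rule mono_trichotomy_at_right_0[OF zero_less_one mono'])
    fix k assume k: "0 < k" "\<forall>\<^sub>F x in at_right 0. k \<le> S x"
    have "0 < S r" if r: "0 < r" for r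
    proof -
      obtain x where "0 < x" "x < r" "k \<le> S x" using small[OF k(2) r] by blast
      then show ?thesis using mono[of x r] k(1) by linarith
    qed
    then show ?thesis using slope_limit_of_S(1)[OF zero_less_one sub k] incr by blast
  next
    fix k assume k: "0 < k" "\<forall>\<^sub>F x in at_right 0. S x \<le> - k"
    obtain x where x: "0 < x" "S x \<le> - k" using small[OF k(2) zero_less_one] by blast
    obtain y where y: "0 < y" "0 < S y" using S_eventually_pos[OF \<alpha> I] by blast
    obtain c where c: "c \<in> I" "S c = 0" using S_zero_between[of x y] x y k(1) by (auto simp: I)
    have "\<exists>!c. c \<in> I \<and> deriv u c = 0"
    proof (rule ex1I[of _ c])
      show "c \<in> I \<and> deriv u c = 0" using c S_sign(3) by blast
      fix d assume d: "d \<in> I \<and> deriv u d = 0"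
      then have "S d = 0" using S_sign(3) by blast
      then show "d = c" using c d S_strict_mono[OF \<alpha>, of c d] S_strict_mono[OF \<alpha>, of d c] by (cases c d rule: linorder_cases) auto
    qed
    moreover have "\<forall>c\<in>I. deriv u c = 0 \<longrightarrow> (\<forall>r\<in>I. u c \<le> u r)"
      using S_zero_imp_min[OF \<alpha>] S_sign(3) by blast
    ultimately show ?thesis using slope_limit_of_S(2)[OF zero_less_one sub k] by blast
  next
    assume S0: "(S \<longlongrightarrow> 0) (at_right 0)"
    have S_pos: "0 < S r" if r: "0 < r" for r
    proof -
      \<comment> \<open>The limit yields a weak inequality only; the detour through
        \<open>r/2\<close> makes it strict at \<open>r\<close>.\<close>
      have "0 \<le> S (r/2)"
      proof (rule tendsto_upperbound[OF S0])
        show "\<forall>\<^sub>F x in at_right 0. S x \<le> S (r/2)"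
          unfolding eventually_at_right[OF r] using r mono by (intro exI[of _ "r/2"]) auto
      qed simp
      also have "S (r/2) < S r" using r by (intro S_strict_mono \<alpha>) (auto simp: I)
      finally show ?thesis .
    qed
    have cl: "0 \<in> closure {0<..<1::real}" by simp
    obtain L where L: "0 \<le> L" "(u \<longlongrightarrow> L) (at_right 0)"
      by (rule u_limit[OF sub cl]) (auto simp: at_within_Ioo)
    show ?thesis
    proof (cases "L = 0")
      case False
      then have "L > 0" using L by simp
      then show ?thesis using slope_limit_of_S(3)[OF zero_less_one sub S0 _ L(2)] incr[OF S_pos] by blast
    next
      case True
      then interpret vanishing_at_origin \<alpha> u I
        using \<alpha> I S_pos L(2) by unfold_locales auto
      show ?thesis
        using cone_or_slope_1
      proof
        assume cone: "\<forall>r>0. u r = sqrt \<alpha> * r"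
        have "deriv u r = sqrt \<alpha>" if r: "r > 0" for r
        proof (rule DERIV_imp_deriv)
          show "(u has_real_derivative sqrt \<alpha>) (at r)"
            by (rule has_field_derivative_transform_within_open[of "\<lambda>r. sqrt \<alpha> * r" _ _ "{0<..}"])
              (use cone r in \<open>auto intro!: derivative_eq_intros\<close>)
        qed
        then have "\<forall>\<^sub>F r in at_right 0. sqrt \<alpha> = deriv u r"
          by (auto simp: eventually_at_filter)
        then have "(deriv u \<longlongrightarrow> sqrt \<alpha>) (at_right 0)"
          by (rule Lim_transform_eventually[OF tendsto_const])
        moreover have "\<forall>r\<in>I. u r = sqrt \<alpha> * r" using cone I by auto
        ultimately show ?thesis by blast
      next
        assume "(deriv u \<longlongrightarrow> 1) (at_right 0)"
        then show ?thesis using incr[OF S_pos] by blast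
      qed
    qed
  qed
qed

text \<open>On the cone \<alpha> / u equals u' / r, so the explicit right-hand side is 0, as is u''.
  The bound \<open>\<alpha> < 1\<close> expresses u'^2 < 1 for the slope
  \<open>sqrt \<alpha>\<close>.\<close>

lemma cone_is_sol:
  assumes "0 < \<alpha>" "\<alpha> < 1"
  shows "is_sol \<alpha> (\<lambda>r. sqrt \<alpha> * r) {0<..}"
proof (rule is_solI[where p = "\<lambda>_. sqrt \<alpha>"])
  fix r :: real assume r: "r \<in> {0<..}"
  have "sqrt \<alpha> * sqrt \<alpha> = \<alpha>" using assms by simp
  then have "\<alpha> / (sqrt \<alpha> * r) = sqrt \<alpha> / r" using assms r by (simp add: divide_simps)
  then show "0 < r \<and> 0 < sqrt \<alpha> * r \<and> (sqrt \<alpha>)\<^sup>2 < 1 \<and>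
      ((\<lambda>r. sqrt \<alpha> * r) has_real_derivative sqrt \<alpha>) (at r) \<and>
      ((\<lambda>_. sqrt \<alpha>) has_real_derivative (1 - (sqrt \<alpha>)\<^sup>2) * (\<alpha> / (sqrt \<alpha> * r) - sqrt \<alpha> / r)) (at r)"
    using assms r by (auto intro!: derivative_eq_intros)
qed (auto simp: is_interval_connected_1)

text \<open>\<open>S\<close> tends to minus infinity, and \<open>sg\<close>, being S / r with r
  below \<open>b\<close>, inherits this. The point of negative flux later provides one side of the
  sign change that locates the maximum.\<close>

lemma (in profile_solution) right_end_neg:
  assumes \<alpha>: "\<alpha> < 0" and ab: "0 \<le> a" "a < b" and I: "I = {a<..<b}" and lim: "(u \<longlongrightarrow> 0) (at_left b)"
  shows "(deriv u \<longlongrightarrow> -1) (at_left b)" "\<exists>r\<in>I. S r < 0"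
proof -
  have evI: "\<forall>\<^sub>F r in at_left b. r \<in> I"
    unfolding eventually_at_left[OF ab(2)] I using ab by (intro exI[of _ a]) auto
  have S_bot: "filterlim S at_bot (at_left b)"
    using ab I lim \<alpha> by (intro S_right_end(2)[of a b]) auto
  then have neg: "\<forall>\<^sub>F r in at_left b. S r < 0" unfolding filterlim_at_bot_dense by blast
  from eventually_happens'[OF trivial_limit_at_left_real eventually_conj[OF evI this]]
  show "\<exists>r\<in>I. S r < 0" by blast
  show "(deriv u \<longlongrightarrow> -1) (at_left b)"
  proof (rule slope_tendsto(2)[OF evI])
    have "filterlim (\<lambda>r. - S r) at_top (at_left b)" using S_bot by (simp add: filterlim_uminus_at_bot)
    then have "filterlim (\<lambda>r. 1 / b * - S r) at_top (at_left b)"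
      using ab by (intro filterlim_tendsto_pos_mult_at_top[OF tendsto_const]) auto
    moreover have "\<forall>\<^sub>F r in at_left b. 1 / b * - S r \<le> - sg r"
      using neg evI
    proof eventually_elim
      case (elim r)
      then have "- S r / b \<le> - S r / r" using ab I by (intro divide_left_mono) auto
      then show ?case using elim ab I by (simp add: S_def)
    qed
    ultimately have "filterlim (\<lambda>r. - sg r) at_top (at_left b)" by (rule filterlim_at_top_mono)
    then show "filterlim sg at_bot (at_left b)" by (simp add: filterlim_uminus_at_bot)
  qed
qed

lemma (in profile_solution) left_end_neg:
  assumes \<alpha>: "\<alpha> < 0" and ab: "0 < a" "a < b" and I: "I = {a<..<b}" and lim: "(u \<longlongrightarrow> 0) (at_right a)"
  shows "(deriv u \<longlongrightarrow> 1) (at_right a)" "\<exists>r\<in>I. 0 < S r"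
proof -
  have evI: "\<forall>\<^sub>F r in at_right a. r \<in> I"
    unfolding eventually_at_right[OF ab(2)] I using ab by (intro exI[of _ b]) auto
  have S_top: "filterlim S at_top (at_right a)"
    using ab I lim \<alpha> by (intro S_left_end(2)[of a b]) auto
  then have S_pos: "\<forall>\<^sub>F r in at_right a. 0 < S r" unfolding filterlim_at_top_dense by blast
  from eventually_happens'[OF trivial_limit_at_right_real eventually_conj[OF evI this]]
  show "\<exists>r\<in>I. 0 < S r" by blast
  show "(deriv u \<longlongrightarrow> 1) (at_right a)"
  proof (rule slope_tendsto(1)[OF evI])
    have "filterlim (\<lambda>r. 1 / b * S r) at_top (at_right a)"
      using ab S_top by (intro filterlim_tendsto_pos_mult_at_top[OF tendsto_const]) auto
    moreover have "\<forall>\<^sub>F r in at_right a. 1 / b * S r \<le> sg r"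
      using S_pos evI
    proof eventually_elim
      case (elim r)
      then have "S r / b \<le> S r / r" using ab I by (intro divide_left_mono) auto
      then show ?case using elim ab I by (simp add: S_def)
    qed
    ultimately show "filterlim sg at_top (at_right a)" by (rule filterlim_at_top_mono)
  qed
qed

lemma (in profile_solution) slope_at_origin_neg:
  assumes \<alpha>: "\<alpha> < 0" and b: "0 < b" and I: "I = {0<..<b}" and neg: "\<exists>r\<in>I. S r < 0"
  shows "\<exists>u0'. (deriv u \<longlongrightarrow> u0') (at_right 0) \<and>
                   ((u0' = 0 \<and> (\<forall>x\<in>I. \<forall>y\<in>I. x < y \<longrightarrow> u y < u x)) \<or>
                    (u0' = -1 \<and> (\<forall>x\<in>I. \<forall>y\<in>I. x < y \<longrightarrow> u y < u x)) \<or>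
                    (u0' = 1 \<and> (\<exists>c\<in>I. \<forall>r\<in>I. u r \<le> u c)))"
proof -
  have decr: "\<forall>x\<in>I. \<forall>y\<in>I. x < y \<longrightarrow> u y < u x" if "\<And>r. r \<in> I \<Longrightarrow> S r < 0"
  proof (intro ballI impI)
    fix x y assume "x \<in> I" "y \<in> I" "x < y"
    then show "u y < u x" by (intro u_strict_antimono that) (simp_all add: I)
  qed
  have sub: "{0<..<b} \<subseteq> I" by (simp add: I)
  have anti: "S y \<le> S x" if "0 < x" "x \<le> y" "y < b" for x y
    using S_strict_antimono[OF \<alpha>, of x y] that by (cases "x = y") (auto simp: I)
  \<comment> \<open>The trichotomy is stated for increasing functions, so it is applied to minus
    \<open>S\<close>, which exchanges its first two cases.\<close>
  then have mono: "\<And>x y. 0 < x \<Longrightarrow> x \<le> y \<Longrightarrow> y < b \<Longrightarrow> - S x \<le> - S y" by simp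
  have small: "\<exists>x>0. x < r \<and> Q x" if "\<forall>\<^sub>F x in at_right 0. Q x" "0 < r" for Q and r :: real
    using eventually_at_right_0_witness[OF that] by blast
  show ?thesis
  proof (rule mono_trichotomy_at_right_0[OF b mono])
    fix k assume k: "0 < k" "\<forall>\<^sub>F x in at_right 0. k \<le> - S x"
    have "S r < 0" if r: "r \<in> I" for r
    proof -
      obtain x where "0 < x" "x < r" "k \<le> - S x" using small[OF k(2), of r] r by (auto simp: I)
      then show ?thesis using anti[of x r] k(1) r by (auto simp: I)
    qed
    moreover have "\<forall>\<^sub>F x in at_right 0. S x \<le> - k" using k(2) by eventually_elim simp
    ultimately show ?thesis using slope_limit_of_S(2)[OF b sub k(1)] decr by blast
  next
    fix k assume k: "0 < k" "\<forall>\<^sub>F x in at_right 0. - S x \<le> - k"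
    then have k': "\<forall>\<^sub>F x in at_right 0. k \<le> S x" by simp
    obtain x where x: "0 < x" "x < b" "k \<le> S x" using small[OF k' b] by blast
    obtain y where y: "y \<in> I" "S y < 0" using neg by blast
    obtain c where c: "c \<in> I" "S c = 0" using S_zero_between[of y x] x y k(1) by (auto simp: I)
    then have "\<exists>c\<in>I. \<forall>r\<in>I. u r \<le> u c" using S_zero_imp_max[OF \<alpha>] by blast
    then show ?thesis using slope_limit_of_S(1)[OF b sub k(1) k'] by blast
  next
    assume "((\<lambda>x. - S x) \<longlongrightarrow> 0) (at_right 0)"
    then have S0: "(S \<longlongrightarrow> 0) (at_right 0)" using tendsto_minus by fastforce
    have S_neg: "S r < 0" if r: "r \<in> I" for r
    proof -
      have r0: "0 < r" "r < b" using r by (auto simp: I)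
      have "S r < S (r/2)" using r0 by (intro S_strict_antimono \<alpha>) (auto simp: I)
      also have "S (r/2) \<le> 0"
      proof (rule tendsto_lowerbound[OF S0])
        show "\<forall>\<^sub>F x in at_right 0. S (r/2) \<le> S x"
          unfolding eventually_at_right[OF r0(1)] using r0 anti by (intro exI[of _ "r/2"]) auto
      qed simp
      finally show ?thesis .
    qed
    have cl: "0 \<in> closure {0<..<b}" using b by simp
    obtain L where L: "0 \<le> L" "(u \<longlongrightarrow> L) (at_right 0)"
      by (rule u_limit[OF sub cl]) (auto simp: at_within_Ioo b)
    \<comment> \<open>No vertex occurs for \<alpha> < 0: the flux is negative here, and
      \<open>u\<close> cannot decrease from the limit 0.\<close>
    have "L \<noteq> 0"
    proof
      assume "L = 0"
      moreover have "\<forall>\<^sub>F r in at_right 0. S r < 0"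
        unfolding eventually_at_right[OF b] using b S_neg I by (intro exI[of _ b]) auto
      ultimately show False using vanishing_left_end_slope[OF b sub] L(2) by simp
    qed
    then have "L > 0" using L by simp
    then show ?thesis using slope_limit_of_S(3)[OF b sub S0 _ L(2)] decr[OF S_neg] by blast
  qed
qed

text \<open>For \<alpha> > 0 the alternative \<open>u0' = sqrt \<alpha>\<close> stands for the cone:
  it has a vertex on the axis, and its constant slope lies strictly between 0 and 1.\<close>

theorem theorem3p3:
  fixes \<alpha> :: real and u :: "real \<Rightarrow> real" and I :: "real set"
  assumes "\<alpha> \<noteq> 0" and "is_max_sol \<alpha> u I"
  shows "(\<alpha> > 0 \<longrightarrow>
            I = {0<..} \<and>
            (\<exists>u0'. (deriv u \<longlongrightarrow> u0') (at_right 0) \<and>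
               ((u0' = 0 \<and> (\<forall>x\<in>I. \<forall>y\<in>I. x < y \<longrightarrow> u x < u y)) \<or>
                (u0' = -1 \<and> (\<exists>!c. c \<in> I \<and> deriv u c = 0) \<and>
                   (\<forall>c\<in>I. deriv u c = 0 \<longrightarrow> (\<forall>r\<in>I. u c \<le> u r))) \<or>
                (u0' = 1 \<and> (\<forall>x\<in>I. \<forall>y\<in>I. x < y \<longrightarrow> u x < u y)) \<or>
                (u0' = sqrt \<alpha> \<and> (\<forall>r\<in>I. u r = sqrt \<alpha> * r)))) \<and>
            filterlim u at_top at_top \<and>
            (\<alpha> < 1 \<longrightarrow> is_sol \<alpha> (\<lambda>r. sqrt \<alpha> * r) {0<..}))
       \<and> (\<alpha> < 0 \<longrightarrow>
            (\<exists>a b. 0 \<le> a \<and> a < b \<and> I = {a<..<b} \<and>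
               (u \<longlongrightarrow> 0) (at_left b) \<and> (deriv u \<longlongrightarrow> -1) (at_left b) \<and>
               (a > 0 \<longrightarrow> (\<exists>c\<in>I. \<forall>r\<in>I. u r \<le> u c) \<and>
                   (u \<longlongrightarrow> 0) (at_right a) \<and> (deriv u \<longlongrightarrow> 1) (at_right a)) \<and>
               (a = 0 \<longrightarrow> (\<exists>u0'. (deriv u \<longlongrightarrow> u0') (at_right 0) \<and>
                   ((u0' = 0 \<and> (\<forall>x\<in>I. \<forall>y\<in>I. x < y \<longrightarrow> u y < u x)) \<or>
                    (u0' = -1 \<and> (\<forall>x\<in>I. \<forall>y\<in>I. x < y \<longrightarrow> u y < u x)) \<or>
                    (u0' = 1 \<and> (\<exists>c\<in>I. \<forall>r\<in>I. u r \<le> u c)))))))"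
proof (rule conjI; rule impI)
  let "(_ \<longrightarrow> ?A) \<and> (_ \<longrightarrow> ?B)" = ?thesis
  interpret profile_solution \<alpha> u I
    using assms(2) by unfold_locales (simp add: is_max_sol_def)
  show ?A if \<alpha>: "\<alpha> > 0"
  proof -
    note I = max_sol_domain_pos[OF assms(2) \<alpha>]
    show ?thesis
      by (intro conjI impI I slope_at_origin_pos[OF \<alpha> I] u_at_top[OF \<alpha> I] cone_is_sol[OF \<alpha>])
  qed
  show ?B if \<alpha>: "\<alpha> < 0"
    using assms(2)
  proof (cases rule: max_sol_domain)
    case (1 a)
    then show ?thesis using domain_bounded[OF \<alpha>] by simp
  next
    case (2 a b)
    note right = right_end_neg[OF \<alpha> 2(1,2,3,5)]
    \<comment> \<open>The flux is positive somewhere near \<open>a\<close> and negative somewhere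
      near \<open>b\<close>; the maximum sits at its zero.\<close>
    have max: "\<exists>c\<in>I. \<forall>r\<in>I. u r \<le> u c" if a: "a > 0"
    proof -
      obtain x y where "x \<in> I" "S x < 0" "y \<in> I" "0 < S y"
        using right(2) left_end_neg(2)[OF \<alpha> a 2(2,3) 2(4)[OF a]] by blast
      then obtain c where "c \<in> I" "S c = 0" using S_zero_between by blast
      then show ?thesis using S_zero_imp_max[OF \<alpha>] by blast
    qed
    show ?thesis
    proof (rule exI[of _ a], rule exI[of _ b], intro conjI 2(1,2,3,5) right(1); rule impI)
      assume a: "0 < a"
      show "(\<exists>c\<in>I. \<forall>r\<in>I. u r \<le> u c) \<and> (u \<longlongrightarrow> 0) (at_right a) \<and> (deriv u \<longlongrightarrow> 1) (at_right a)"
        using max[OF a] 2(4)[OF a] left_end_neg(1)[OF \<alpha> a 2(2,3) 2(4)[OF a]] by blast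
    next
      assume a: "a = 0"
      have "0 < b" "I = {0<..<b}" using 2(2,3) a by simp_all
      from slope_at_origin_neg[OF \<alpha> this right(2)]
      show "\<exists>u0'. (deriv u \<longlongrightarrow> u0') (at_right 0) \<and>
               ((u0' = 0 \<and> (\<forall>x\<in>I. \<forall>y\<in>I. x < y \<longrightarrow> u y < u x)) \<or>
                (u0' = -1 \<and> (\<forall>x\<in>I. \<forall>y\<in>I. x < y \<longrightarrow> u y < u x)) \<or>
                (u0' = 1 \<and> (\<exists>c\<in>I. \<forall>r\<in>I. u r \<le> u c)))" .
    qed
  qed
qed

end
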